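(* Let $P$ be a rational polygon all of whose vertices have algebraic coordinates. Then the billiard in $P$ has at most finitely many $\lambda$-stable periodic cylinders.
   Context: A polygon is rational if all its angles are rational multiples of $\pi$. For a polygon $P$ with sides labeled $1,\dots,d$, let $\Phi$ be its billiard map (collision to collision, specular reflection), in coordinates $(s,\theta)$ with $s$ arc length on $\partial P$ and $\theta\in(-\pi/2,\pi/2)$ the angle from the inward normal. For $\lambda>0$ let $R_\lambda(s,\theta)=(s,\lambda\theta)$ and $\Phi_\lambda:=R_\lambda\circ\Phi$ (pinball billiard for $\lambda\ne1$). A periodic cylinder is a maximal one-parameter family of parallel periodic orbits of $\Phi$ with the same itinerary (sequence of sides hit). A periodic orbit $q$ of $\Phi$ is $\lambda^{+}$-stable (resp. $\lambda^-$-stable) if there exist a strictly decreasing (resp. strictly increasing) sequence $\lambda_n\to1$ and periodic orbits $q_n$ of $\Phi_{\lambda_n}$ with the same itinerary as $q$ such that $q_n\to q$. A periodic cylinder is $\lambda$-stable if it contains a $\lambda^+$-stable periodic orbit and a $\lambda^-$-stable periodic orbit. *)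

theory Defs
  imports "HOL-Analysis.Analysis" "HOL-Computational_Algebra.Polynomial"
begin

(* A polygon is given by d vertices v 0, ..., v (d-1) (complex numbers = points of R^2),
   listed counterclockwise; side i runs from v i to v (nxt d i). *)

definition nxt :: "nat \<Rightarrow> nat \<Rightarrow> nat" where
  "nxt d i = Suc i mod d"

definition prv :: "nat \<Rightarrow> nat \<Rightarrow> nat" where
  "prv d i = (i + d - 1) mod d"

definition side :: "(nat \<Rightarrow> complex) \<Rightarrow> nat \<Rightarrow> nat \<Rightarrow> complex set" where
  "side v d i = closed_segment (v i) (v (nxt d i))"

definition simple_polygon :: "(nat \<Rightarrow> complex) \<Rightarrow> nat \<Rightarrow> bool" where
  "simple_polygon v d \<longleftrightarrow> 3 \<le> d \<and> (\<forall>i<d. v i \<noteq> v (nxt d i)) \<and>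
     (\<forall>i<d. \<forall>j<d. i \<noteq> j \<longrightarrow>
        side v d i \<inter> side v d j =
          (if j = nxt d i then {v j} else if i = nxt d j then {v i} else {}))"

(* counterclockwise orientation: positive signed (shoelace) area *)
definition ccw :: "(nat \<Rightarrow> complex) \<Rightarrow> nat \<Rightarrow> bool" where
  "ccw v d \<longleftrightarrow> (\<Sum>i<d. Im (cnj (v i) * v (nxt d i))) > 0"

(* interior angle at vertex i of a counterclockwise polygon *)
definition interior_angle :: "(nat \<Rightarrow> complex) \<Rightarrow> nat \<Rightarrow> nat \<Rightarrow> real" where
  "interior_angle v d i = pi - Arg ((v (nxt d i) - v i) / (v i - v (prv d i)))"

definition rational_polygon :: "(nat \<Rightarrow> complex) \<Rightarrow> nat \<Rightarrow> bool" where
  "rational_polygon v d \<longleftrightarrow> (\<forall>i<d. interior_angle v d i / pi \<in> \<rat>)"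

definition algebraic_vertices :: "(nat \<Rightarrow> complex) \<Rightarrow> nat \<Rightarrow> bool" where
  "algebraic_vertices v d \<longleftrightarrow> (\<forall>i<d. algebraic (Re (v i)) \<and> algebraic (Im (v i)))"

(* boundary, arc length parametrisation (s = 0 at vertex v 0, counterclockwise) *)
definition on_boundary :: "(nat \<Rightarrow> complex) \<Rightarrow> nat \<Rightarrow> complex \<Rightarrow> bool" where
  "on_boundary v d p \<longleftrightarrow> (\<exists>i<d. p \<in> side v d i)"

definition side_len :: "(nat \<Rightarrow> complex) \<Rightarrow> nat \<Rightarrow> nat \<Rightarrow> real" where
  "side_len v d i = cmod (v (nxt d i) - v i)"

definition cum :: "(nat \<Rightarrow> complex) \<Rightarrow> nat \<Rightarrow> nat \<Rightarrow> real" where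
  "cum v d i = (\<Sum>j<i. side_len v d j)"

definition perim :: "(nat \<Rightarrow> complex) \<Rightarrow> nat \<Rightarrow> real" where
  "perim v d = cum v d d"

(* admissible arc-length positions: interior points of sides (billiard map undefined at vertices) *)
definition valid_pos :: "(nat \<Rightarrow> complex) \<Rightarrow> nat \<Rightarrow> real \<Rightarrow> bool" where
  "valid_pos v d s \<longleftrightarrow> 0 \<le> s \<and> s < perim v d \<and> (\<forall>i<d. s \<noteq> cum v d i)"

definition side_of :: "(nat \<Rightarrow> complex) \<Rightarrow> nat \<Rightarrow> real \<Rightarrow> nat" where
  "side_of v d s = (THE i. i < d \<and> cum v d i < s \<and> s < cum v d (Suc i))"

definition unit_tan :: "(nat \<Rightarrow> complex) \<Rightarrow> nat \<Rightarrow> nat \<Rightarrow> complex" where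
  "unit_tan v d i = (v (nxt d i) - v i) / complex_of_real (side_len v d i)"

(* inward unit normal (left normal, polygon counterclockwise) *)
definition inward_normal :: "(nat \<Rightarrow> complex) \<Rightarrow> nat \<Rightarrow> nat \<Rightarrow> complex" where
  "inward_normal v d i = \<i> * unit_tan v d i"

definition bpt :: "(nat \<Rightarrow> complex) \<Rightarrow> nat \<Rightarrow> real \<Rightarrow> complex" where
  "bpt v d s = (let i = side_of v d s in v i + complex_of_real (s - cum v d i) * unit_tan v d i)"

(* phase space: (s, theta), s arc length, theta in (-pi/2, pi/2) angle from inward normal *)
definition valid_state :: "(nat \<Rightarrow> complex) \<Rightarrow> nat \<Rightarrow> real \<times> real \<Rightarrow> bool" where
  "valid_state v d x \<longleftrightarrow> valid_pos v d (fst x) \<and> - (pi/2) < snd x \<and> snd x < pi/2"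

definition out_dir :: "(nat \<Rightarrow> complex) \<Rightarrow> nat \<Rightarrow> real \<times> real \<Rightarrow> complex" where
  "out_dir v d x = inward_normal v d (side_of v d (fst x)) * cis (snd x)"

definition hits :: "(nat \<Rightarrow> complex) \<Rightarrow> nat \<Rightarrow> real \<times> real \<Rightarrow> real \<Rightarrow> bool" where
  "hits v d x s' \<longleftrightarrow> valid_state v d x \<and> valid_pos v d s' \<and>
     (\<exists>t>0. bpt v d s' = bpt v d (fst x) + complex_of_real t * out_dir v d x \<and>
        (\<forall>t'. 0 < t' \<and> t' < t \<longrightarrow>
           \<not> on_boundary v d (bpt v d (fst x) + complex_of_real t' * out_dir v d x)))"

(* Phi_lambda = R_lambda o Phi as a partial map: None where undefined
   (trajectory hits a vertex, or the rescaled angle leaves (-pi/2,pi/2)).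
   At the new collision point on side j the direction u is reflected specularly
   (u' = t_j^2 * conj u, t_j the unit tangent), theta' is its angle from the inward normal,
   and then theta' is multiplied by lambda. *)
definition pinball :: "(nat \<Rightarrow> complex) \<Rightarrow> nat \<Rightarrow> real \<Rightarrow> real \<times> real \<Rightarrow> (real \<times> real) option" where
  "pinball v d lam x =
     (if \<exists>s'. hits v d x s' then
        (let s' = (THE s'. hits v d x s');
             j = side_of v d s';
             u' = (unit_tan v d j)\<^sup>2 * cnj (out_dir v d x);
             th' = Arg (u' / inward_normal v d j);
             y = (s', lam * th')
         in if valid_state v d y then Some y else None)
      else None)"

definition orb :: "(nat \<Rightarrow> complex) \<Rightarrow> nat \<Rightarrow> real \<Rightarrow> real \<times> real \<Rightarrow> nat \<Rightarrow> (real \<times> real) option" where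
  "orb v d lam x k = ((\<lambda>y. Option.bind y (pinball v d lam)) ^^ k) (Some x)"

definition periodic_pt :: "(nat \<Rightarrow> complex) \<Rightarrow> nat \<Rightarrow> real \<Rightarrow> real \<times> real \<Rightarrow> bool" where
  "periodic_pt v d lam x \<longleftrightarrow> valid_state v d x \<and> (\<exists>n>0. orb v d lam x n = Some x)"

definition itin :: "(nat \<Rightarrow> complex) \<Rightarrow> nat \<Rightarrow> real \<Rightarrow> real \<times> real \<Rightarrow> nat \<Rightarrow> nat" where
  "itin v d lam x k = side_of v d (fst (the (orb v d lam x k)))"

definition lam_plus_stable :: "(nat \<Rightarrow> complex) \<Rightarrow> nat \<Rightarrow> real \<times> real \<Rightarrow> bool" where
  "lam_plus_stable v d x \<longleftrightarrow> periodic_pt v d 1 x \<and>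
     (\<exists>lams ys. (\<forall>n. lams (Suc n) < lams n) \<and> lams \<longlonglongrightarrow> 1 \<and>
        (\<forall>n. periodic_pt v d (lams n) (ys n) \<and> itin v d (lams n) (ys n) = itin v d 1 x) \<and>
        ys \<longlonglongrightarrow> x)"

definition lam_minus_stable :: "(nat \<Rightarrow> complex) \<Rightarrow> nat \<Rightarrow> real \<times> real \<Rightarrow> bool" where
  "lam_minus_stable v d x \<longleftrightarrow> periodic_pt v d 1 x \<and>
     (\<exists>lams ys. (\<forall>n. 0 < lams n \<and> lams n < lams (Suc n)) \<and> lams \<longlonglongrightarrow> 1 \<and>
        (\<forall>n. periodic_pt v d (lams n) (ys n) \<and> itin v d (lams n) (ys n) = itin v d 1 x) \<and>
        ys \<longlonglongrightarrow> x)"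

(* starting states of all periodic billiard orbits parallel to that of x (same side,
   same angle) with the same itinerary *)
definition cyl_base :: "(nat \<Rightarrow> complex) \<Rightarrow> nat \<Rightarrow> real \<times> real \<Rightarrow> (real \<times> real) set" where
  "cyl_base v d x = {y. periodic_pt v d 1 y \<and> itin v d 1 y = itin v d 1 x \<and> snd y = snd x}"

definition periodic_cylinder :: "(nat \<Rightarrow> complex) \<Rightarrow> nat \<Rightarrow> (real \<times> real) set \<Rightarrow> bool" where
  "periodic_cylinder v d C \<longleftrightarrow>
     (\<exists>x. periodic_pt v d 1 x \<and> infinite (cyl_base v d x) \<and>
          C = {z. \<exists>y\<in>cyl_base v d x. \<exists>k. orb v d 1 y k = Some z})"

definition lambda_stable_cylinder :: "(nat \<Rightarrow> complex) \<Rightarrow> nat \<Rightarrow> (real \<times> real) set \<Rightarrow> bool" where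
  "lambda_stable_cylinder v d C \<longleftrightarrow> periodic_cylinder v d C \<and>
     (\<exists>x\<in>C. lam_plus_stable v d x) \<and> (\<exists>x\<in>C. lam_minus_stable v d x)"

end

theory Submission
  imports Defs "HOL-Computational_Algebra.Polynomial_Factorial"
    "HOL-Computational_Algebra.Fundamental_Theorem_Algebra"
begin

text \<open>
  Along an orbit with a given itinerary the angles satisfy
  \<open>\<theta>\<^bsub>k+1\<^esub> = \<lambda> (\<delta>\<^sub>k - \<theta>\<^sub>k)\<close>, where \<open>\<delta>\<^sub>k\<close> depends only on the two sides and is a rational
  multiple of \<open>\<pi>\<close>. For \<open>\<lambda> \<noteq> 1\<close> this has a unique periodic solution, and as \<open>\<lambda> \<rightarrow> 1\<close> its limit is again a
  rational multiple of \<open>\<pi>\<close>; so all angles of a stable orbit are rational multiples of \<open>\<pi>\<close>. On the other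
  hand, unfolding a periodic billiard orbit shows that the square of its direction lies in the number
  field generated by the vertex coordinates and \<open>\<i>\<close>, which contains only finitely many roots of unity.
  Hence only finitely many angles occur. Finally, displacing a periodic orbit parallel to itself
  until it first runs into a vertex attaches to its cylinder a starting point on a side, an angle and
  an orientation; there are finitely many such data for finitely many angles, and they determine the cylinder
  because two families ending at the same point on the same side overlap.
\<close>

section \<open>Roots of unity in finite-dimensional rational algebras\<close>

text \<open>The obstacle behind the last step is that itineraries of periodic orbits in a fixed
  direction have no a priori length bound, so finitely many angles do not at once give finitely many
  cylinders. The finite data therefore record no itinerary: a line through a vertex at a given angle
  to a side meets the line of that side in one point, and pushing two families inward from a common
  limiting point by the same amount produces one and the same phase point.

  The square of the direction appears because the unfolded orbit closes up under a translation by
  \<open>a = L * u\<close> with \<open>L\<close> real, whence \<open>u / cnj u = a / cnj a\<close>.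
  Each reflection in a side involves its unit tangent only through the square, which is the edge
  vector divided by its conjugate; no side length, hence no square root, enters.

  The limiting angle is a quotient of derivatives: over an even period \<open>p\<close> the
  recursion gives \<open>(1 - l ^ p) * \<theta> = S l p\<close>, both sides vanish at
  \<open>l = 1\<close>, and the derivative of \<open>S\<close> there is again a rational multiple of
  pi.\<close>

interpretation rat_vs: vector_space "\<lambda>(q::rat) (x::complex). of_rat q * x"
  by unfold_locales (auto simp: algebra_simps of_rat_add of_rat_mult)

text \<open>A subfield of finite degree over the rationals, stated as an algebra: inverses come for
  free, see \<open>fin_subalg_inverse\<close>. A finite spanning set is enough, since its
  cardinality already bounds the degree of every element.\<close>

definition fin_subalg :: "complex set \<Rightarrow> bool" where
  "fin_subalg A \<longleftrightarrow> (\<exists>B. finite B \<and> A = rat_vs.span B) \<and> 1 \<in> A \<and> (\<forall>x\<in>A. \<forall>y\<in>A. x * y \<in> A)"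

section \<open>Integer polynomials annihilating elements of a finite-dimensional algebra\<close>

lemma map_poly_of_int_mult:
  "map_poly of_int (p * q) = (map_poly of_int p * map_poly of_int q :: complex poly)"
  by (rule poly_eqI) (simp add: coeff_map_poly coeff_mult)

lemma map_poly_of_int_add:
  "map_poly of_int (p + q) = (map_poly of_int p + map_poly of_int q :: complex poly)"
  by (rule poly_eqI) (simp add: coeff_map_poly)

lemma map_poly_of_int_smult:
  "map_poly of_int (smult c p) = (smult (of_int c) (map_poly of_int p) :: complex poly)"
  by (rule poly_eqI) (simp add: coeff_map_poly)

lemma map_poly_of_int_eq_0_iff: "map_poly of_int p = (0 :: complex poly) \<longleftrightarrow> p = 0"
  by (auto simp: poly_eq_iff coeff_map_poly)

lemma poly_sum_upto:
  fixes p :: "'a::comm_semiring_1 poly"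
  assumes "degree p \<le> n"
  shows "poly p x = (\<Sum>i\<le>n. coeff p i * x ^ i)"
  unfolding poly_altdef
  using assms by (intro sum.mono_neutral_left) (auto simp: coeff_eq_0)

lemma degree_map_poly_of_int: "degree (map_poly of_int p :: complex poly) = degree p"
  by (rule degree_map_poly) auto

lemma common_denominator:
  fixes c :: "nat \<Rightarrow> rat"
  assumes "finite I"
  shows "\<exists>M::int. M \<noteq> 0 \<and> (\<forall>i\<in>I. of_int M * c i \<in> \<int>)"
  using assms
proof (induction I)
  case (insert i I)
  then obtain M :: int where M: "M \<noteq> 0" "\<forall>i\<in>I. of_int M * c i \<in> \<int>" by auto
  obtain a b :: int where ab: "c i = of_int a / of_int b" "b > 0"
    by (metis quotient_of_denom_pos quotient_of_div surj_pair)
  have "of_int (M * b) * c j \<in> \<int>" if "j \<in> insert i I" for j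
  proof (cases "j = i")
    case True
    then have "of_int (M * b) * c j = of_int (M * a)" using ab by (simp add: field_simps)
    then show ?thesis by (metis Ints_of_int)
  next
    case False
    then have "of_int b * (of_int M * c j) \<in> \<int>" using M that by auto
    then show ?thesis by (simp add: mult_ac)
  qed
  then show ?case using M ab by (intro exI[of _ "M * b"]) auto
qed (auto intro: exI[of _ 1])

text \<open>The \<open>card B + 1\<close> powers \<open>z ^ 0, ..., z ^ card B\<close> are linearly
  dependent over the rationals; clearing denominators gives the polynomial.\<close>

lemma int_poly_of_powers_in_span:
  assumes "finite B" and pow: "\<And>k. z ^ k \<in> rat_vs.span B"
  shows "\<exists>q::int poly. q \<noteq> 0 \<and> degree q \<le> card B \<and> poly (map_poly of_int q) z = 0"
proof -
  define D where "D = card B"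
  have "\<exists>c :: nat \<Rightarrow> rat. (\<exists>k\<le>D. c k \<noteq> 0) \<and> (\<Sum>k\<le>D. of_rat (c k) * z ^ k) = 0"
  \<comment> \<open>Linear dependence is a property of sets, so coinciding powers have to be treated
    apart; they give the relation \<open>z ^ j - z ^ k = 0\<close> directly.\<close>
  proof (cases "inj_on (\<lambda>k. z ^ k) {..D}")
    case True
    let ?S = "(\<lambda>k. z ^ k) ` {..D}"
    have "rat_vs.dependent ?S"
    proof (rule ccontr)
      assume "rat_vs.independent ?S"
      moreover have "?S \<subseteq> rat_vs.span B" using pow by auto
      ultimately have "card ?S \<le> card B"
        using rat_vs.independent_span_bound[OF assms(1)] by blast
      then show False using card_image[OF True] by (simp add: D_def)
    qed
    then obtain u where u: "\<exists>v\<in>?S. u v \<noteq> 0" "(\<Sum>v\<in>?S. of_rat (u v) * v) = 0"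
      by (subst (asm) rat_vs.dependent_finite) auto
    show ?thesis
      using u by (intro exI[of _ "\<lambda>k. u (z ^ k)"]) (auto simp: sum.reindex[OF True])
  next
    case False
    then obtain j k where jk: "j \<le> D" "k \<le> D" "j \<noteq> k" "z ^ j = z ^ k"
      by (auto simp: inj_on_def)
    define c :: "nat \<Rightarrow> rat" where "c = (\<lambda>i. if i = j then 1 else if i = k then -1 else 0)"
    have "(\<Sum>i\<le>D. of_rat (c i) * z ^ i) = (\<Sum>i\<le>D. (if i = j then z ^ j else 0) - (if i = k then z ^ k else 0))"
      using jk by (intro sum.cong) (auto simp: c_def)
    also have "\<dots> = 0" using jk by (simp add: sum_subtractf)
    finally show ?thesis using jk by (intro exI[of _ c]) (auto simp: c_def)
  qed
  then obtain c :: "nat \<Rightarrow> rat" and k0 where c: "k0 \<le> D" "c k0 \<noteq> 0" "(\<Sum>k\<le>D. of_rat (c k) * z ^ k) = 0"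
    by auto
  obtain M :: int where M: "M \<noteq> 0" "\<forall>i\<in>{..D}. of_int M * c i \<in> \<int>"
    using common_denominator[of "{..D}" c] by auto
  define m where "m = (\<lambda>i. \<lfloor>of_int M * c i\<rfloor>)"
  have m: "of_int (m i) = of_int M * c i" if "i \<le> D" for i
    using M that unfolding m_def by (metis Ints_cases atMost_iff floor_of_int)
  have m': "(of_int (m i) :: complex) = of_int M * of_rat (c i)" if "i \<le> D" for i
    using m[OF that] by (metis of_rat_mult of_rat_of_int_eq)
  define q where "q = (\<Sum>k\<le>D. monom (m k) k)"
  have cq: "coeff q k = (if k \<le> D then m k else 0)" for k
    by (simp add: q_def coeff_sum)
  have "m k0 \<noteq> 0" using m[of k0] c M by auto
  then have "q \<noteq> 0" using cq[of k0] c by auto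
  moreover have dq: "degree q \<le> D" by (rule degree_le) (simp add: cq)
  moreover have "poly (map_poly of_int q) z = 0"
  proof -
    have "poly (map_poly of_int q) z = (\<Sum>k\<le>D. of_int (m k) * z ^ k)"
      by (subst poly_sum_upto[of _ D]) (use dq in \<open>simp_all add: degree_map_poly_of_int coeff_map_poly cq\<close>)
    also have "\<dots> = (\<Sum>k\<le>D. of_int M * (of_rat (c k) * z ^ k))"
      by (intro sum.cong) (auto simp: m')
    also have "\<dots> = of_int M * (\<Sum>k\<le>D. of_rat (c k) * z ^ k)" by (simp add: sum_distrib_left)
    finally show ?thesis using c by simp
  qed
  ultimately show ?thesis using D_def by blast
qed

lemma fin_subalgD:
  assumes "fin_subalg A"
  shows "x \<in> A \<Longrightarrow> y \<in> A \<Longrightarrow> x + y \<in> A" "x \<in> A \<Longrightarrow> y \<in> A \<Longrightarrow> x * y \<in> A" "1 \<in> A" "0 \<in> A"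
    "x \<in> A \<Longrightarrow> y \<in> A \<Longrightarrow> x - y \<in> A" "x \<in> A \<Longrightarrow> - x \<in> A" "x \<in> A \<Longrightarrow> of_rat q * x \<in> A"
    "of_rat q \<in> A" "x \<in> A \<Longrightarrow> x ^ n \<in> A"
proof -
  show *: "x \<in> A \<Longrightarrow> y \<in> A \<Longrightarrow> x + y \<in> A" "x \<in> A \<Longrightarrow> y \<in> A \<Longrightarrow> x * y \<in> A" "1 \<in> A" "0 \<in> A"
    "x \<in> A \<Longrightarrow> y \<in> A \<Longrightarrow> x - y \<in> A" "x \<in> A \<Longrightarrow> - x \<in> A" for x y
    using assms rat_vs.span_add rat_vs.span_zero rat_vs.span_diff rat_vs.span_neg
    unfolding fin_subalg_def by auto
  show **: "x \<in> A \<Longrightarrow> of_rat q * x \<in> A" for x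
    using assms rat_vs.span_scale unfolding fin_subalg_def by auto
  show "of_rat q \<in> A" using **[OF *(3)] by simp
  show "x \<in> A \<Longrightarrow> x ^ n \<in> A" using * by (induction n) auto
qed

lemma fin_subalg_sum:
  assumes "fin_subalg A" and "\<And>i. i \<in> I \<Longrightarrow> f i \<in> A"
  shows "sum f I \<in> A"
  using assms(2) by (induction I rule: infinite_finite_induct) (auto intro: fin_subalgD[OF assms(1)])

lemma fin_subalg_algebraic:
  assumes "fin_subalg A" "x \<in> A"
  shows "algebraic x"
proof -
  obtain B where B: "finite B" "A = rat_vs.span B" using assms fin_subalg_def by auto
  then obtain q :: "int poly" where "q \<noteq> 0" "poly (map_poly of_int q) x = 0"
    using int_poly_of_powers_in_span[of B x] fin_subalgD(9)[OF assms] by auto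
  then show ?thesis
    by (intro algebraicI[of "map_poly of_int q"]) (auto simp: coeff_map_poly map_poly_of_int_eq_0_iff)
qed

text \<open>A nonzero \<open>x\<close> is a root of some integer polynomial \<open>a + X * q\<close>
  with \<open>a\<close> nonzero, so \<open>- q(x) / a\<close> is its inverse, and this is a
  polynomial expression in \<open>x\<close>.\<close>

lemma fin_subalg_inverse:
  assumes A: "fin_subalg A" "x \<in> A"
  shows "inverse x \<in> A"
proof (cases "x = 0")
  case True
  then show ?thesis using A by simp
next
  case False
  obtain p :: "int poly" where p: "coeff p 0 \<noteq> 0" "poly (map_poly of_int p) x = 0"
    using algebraicE'_nonzero[OF fin_subalg_algebraic[OF A] False] by metis
  define a q where "a = coeff p 0" and "q = poly_shift 1 p"
  have "p = pCons a q" by (rule poly_eqI) (auto simp: a_def q_def coeff_pCons coeff_poly_shift split: nat.split)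
  then have e: "of_int a + x * poly (map_poly of_int q) x = 0" using p by (simp add: map_poly_pCons)
  have "poly (map_poly of_int q) x \<in> A"
    unfolding poly_altdef
    using fin_subalgD(2,9)[OF A(1)] fin_subalgD(8)[OF A(1), of "of_int _"] A
    by (intro fin_subalg_sum[OF A(1)]) (auto simp: coeff_map_poly)
  then have "of_rat (- 1 / of_int a) * poly (map_poly of_int q) x \<in> A"
    using fin_subalgD(7)[OF A(1)] by blast
  also have "of_rat (- 1 / of_int a) * poly (map_poly of_int q) x = inverse x"
  proof -
    have "of_int a \<noteq> (0::complex)" using p a_def by auto
    moreover have "x * poly (map_poly of_int q) x = - of_int a"
      using e by (metis add_eq_0_iff2 add.commute)
    moreover have "of_rat (- 1 / of_int a) = (- 1 / of_int a :: complex)"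
      by (simp add: of_rat_divide of_rat_minus)
    ultimately have "x * (of_rat (- 1 / of_int a) * poly (map_poly of_int q) x) = 1"
      by (simp add: mult.left_commute[of x])
    then show ?thesis by (rule inverse_unique[symmetric])
  qed
  finally show ?thesis .
qed

text \<open>Reduces every closure-under-multiplication claim below to spanning elements.\<close>

lemma span_mult_right:
  assumes "x \<in> rat_vs.span B" and "\<And>b. b \<in> B \<Longrightarrow> b * c \<in> rat_vs.span C"
  shows "x * c \<in> rat_vs.span C"
  using assms(1)
proof (induction rule: rat_vs.span_induct_alt)
  case base
  then show ?case by (simp add: rat_vs.span_zero)
next
  case (step q b y)
  have "(of_rat q * b + y) * c = of_rat q * (b * c) + y * c" by (simp add: algebra_simps)
  then show ?case using step assms(2) rat_vs.span_add rat_vs.span_scale by metis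
qed

text \<open>The products \<open>b * a ^ e\<close> with \<open>e < n\<close> span the extension: an
  integer polynomial of degree \<open>n\<close> with root \<open>a\<close>, not necessarily minimal,
  rewrites \<open>a ^ n\<close> in lower powers.\<close>

lemma fin_subalg_adjoin:
  assumes A: "fin_subalg A" and a: "algebraic a"
  shows "\<exists>A'. fin_subalg A' \<and> A \<subseteq> A' \<and> a \<in> A'"
proof -
  obtain B where B: "finite B" "A = rat_vs.span B" using A fin_subalg_def by auto
  obtain p :: "int poly" where p: "p \<noteq> 0" "poly (map_poly of_int p) a = 0"
    using algebraicE'[OF a] by metis
  define n where "n = degree p"
  have dp: "degree (map_poly of_int p :: complex poly) \<le> n" by (simp add: n_def degree_map_poly_of_int)
  have n0: "n > 0"
  proof (rule ccontr)
    assume "\<not> n > 0"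
    then obtain c where "p = [:c:]" using n_def degree_eq_zeroE by (metis not_gr_zero)
    then show False using p by (auto simp: map_poly_pCons)
  qed
  define C where "C = (\<lambda>(b,e). b * a ^ e) ` (B \<times> {..<n})"
  define A' where "A' = rat_vs.span C"
  have CI: "x * a ^ e \<in> A'" if "x \<in> A" "e < n" for x e
    unfolding A'_def
    by (rule span_mult_right[of x B]) (use that B in \<open>auto intro!: rat_vs.span_base simp: C_def\<close>)
  have sub: "A \<subseteq> A'" using CI[of _ 0] n0 by auto
  have an: "a ^ n = (\<Sum>i<n. of_rat (- of_int (coeff p i) / of_int (coeff p n)) * a ^ i)"
  proof -
    have nz: "of_int (coeff p n) \<noteq> (0::complex)" using p by (simp add: n_def)
    have "0 = (\<Sum>i\<le>n. of_int (coeff p i) * a ^ i)"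
      using p poly_sum_upto[OF dp, of a] by (simp add: coeff_map_poly)
    also have "\<dots> = (\<Sum>i<n. of_int (coeff p i) * a ^ i) + of_int (coeff p n) * a ^ n"
      by (simp add: lessThan_Suc_atMost[symmetric])
    finally have "of_int (coeff p n) * a ^ n = - (\<Sum>i<n. of_int (coeff p i) * a ^ i)"
      by (metis add.commute add_eq_0_iff2)
    then have "a ^ n = - (\<Sum>i<n. of_int (coeff p i) * a ^ i) / of_int (coeff p n)"
      using nz by (simp add: field_simps)
    then show ?thesis
      by (simp add: sum_negf[symmetric] sum_divide_distrib of_rat_divide of_rat_minus)
  qed
  have step: "x * a \<in> A'" if "x \<in> A'" for x
    unfolding A'_def
  proof (rule span_mult_right[of x C])
    show "x \<in> rat_vs.span C" using that A'_def by simp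
    fix c assume "c \<in> C"
    then obtain b e where be: "b \<in> B" "e < n" "c = b * a ^ e" unfolding C_def by auto
    then have bA: "b \<in> A" using B rat_vs.span_base by auto
    show "c * a \<in> rat_vs.span C"
    proof (cases "Suc e < n")
      case True
      then show ?thesis using CI[OF bA True] be by (simp add: A'_def mult_ac)
    next
      case False
      then have "c * a = b * a ^ n" using be by (metis Suc_lessI mult.assoc power_Suc2)
      also have "\<dots> = (\<Sum>i<n. of_rat (- of_int (coeff p i) / of_int (coeff p n)) * b * a ^ i)"
        unfolding an by (simp add: sum_distrib_left mult_ac)
      also have "\<dots> \<in> A'"
        unfolding A'_def
        by (rule rat_vs.span_sum, fold A'_def, rule CI) (use bA fin_subalgD(6,7)[OF A] in auto)
      finally show ?thesis by (simp add: A'_def)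
    qed
  qed
  have steps: "x * a ^ e \<in> A'" if "x \<in> A'" for x e
    by (induction e) (use step that in \<open>auto simp: mult.assoc[symmetric] power_Suc2 simp del: power_Suc\<close>)
  have mA: "y * b \<in> A'" if "y \<in> A'" "b \<in> A" for y b
    unfolding A'_def
  proof (rule span_mult_right[of y C])
    show "y \<in> rat_vs.span C" using that A'_def by simp
    fix c assume "c \<in> C"
    then obtain b' e where be: "b' \<in> B" "e < n" "c = b' * a ^ e" unfolding C_def by auto
    then have "b' * b \<in> A" using B rat_vs.span_base that fin_subalgD(2)[OF A] by auto
    from CI[OF this be(2)] show "c * b \<in> rat_vs.span C" using be by (simp add: A'_def mult_ac)
  qed
  have "x * y \<in> A'" if "x \<in> A'" "y \<in> A'" for x y
    unfolding A'_def
  proof (rule span_mult_right[of x C])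
    show "x \<in> rat_vs.span C" using that A'_def by simp
    fix c assume "c \<in> C"
    then obtain b e where be: "b \<in> B" "e < n" "c = b * a ^ e" unfolding C_def by auto
    then have "y * b * a ^ e \<in> A'" using steps[OF mA[OF that(2)]] B rat_vs.span_base by auto
    then show "c * y \<in> rat_vs.span C" using be by (simp add: A'_def mult_ac)
  qed
  moreover have "1 \<in> A'" using sub fin_subalgD[OF A] by auto
  moreover have "finite C" using B by (simp add: C_def)
  ultimately have "fin_subalg A'" unfolding fin_subalg_def using A'_def by blast
  moreover have "a \<in> A'" using step[OF \<open>1 \<in> A'\<close>] by simp
  ultimately show ?thesis using sub by blast
qed

lemma fin_subalg_contains_finite:
  assumes "finite S" "\<And>a. a \<in> S \<Longrightarrow> algebraic a"
  shows "\<exists>A. fin_subalg A \<and> S \<subseteq> A"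
  using assms
proof (induction S)
  case empty
  have "fin_subalg (rat_vs.span {1})"
    unfolding fin_subalg_def
  proof (intro conjI ballI exI[of _ "{1::complex}"])
    fix x y :: complex assume "x \<in> rat_vs.span {1}" "y \<in> rat_vs.span {1}"
    then show "x * y \<in> rat_vs.span {1}"
      using span_mult_right[of x "{1}" y "{1}"] by auto
  qed (auto intro: rat_vs.span_base)
  then show ?case by blast
next
  case (insert a S)
  then obtain A where "fin_subalg A" "S \<subseteq> A" by auto
  then show ?case using fin_subalg_adjoin[of A a] insert by blast
qed

section \<open>Finitely many roots of unity in a finite-dimensional algebra\<close>

text \<open>Multiplying by \<open>X - z\<close> with \<open>z\<close> on the unit circle makes each
  new coefficient a difference of two old ones up to a unimodular factor, so the bound at most
  doubles with each root.\<close>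

lemma coeff_bound_unit_roots:
  fixes p :: "complex poly"
  assumes "\<And>z. poly p z = 0 \<Longrightarrow> cmod z = 1"
  shows "cmod (coeff p k) \<le> cmod (lead_coeff p) * 2 ^ degree p"
  using assms
proof (induction "degree p" arbitrary: p k)
  case 0
  then show ?case by (cases k) (auto simp: coeff_eq_0)
next
  case (Suc n)
  then have "\<not> constant (poly p)" by (metis constant_degree nat.distinct(1))
  then obtain z where z: "poly p z = 0" using fundamental_theorem_of_algebra by blast
  then obtain q where q: "p = [:-z, 1:] * q" by (metis dvdE poly_eq_0_iff_dvd)
  have q0: "q \<noteq> 0" using Suc q by auto
  have dq: "degree p = Suc (degree q)" using q q0 by (subst q, subst degree_mult_eq) auto
  have lq: "lead_coeff p = lead_coeff q" unfolding q lead_coeff_mult by simp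
  have IH: "cmod (coeff q j) \<le> cmod (lead_coeff q) * 2 ^ n" for j
  proof -
    have "n = degree q" using dq Suc by simp
    moreover have "\<And>z. poly q z = 0 \<Longrightarrow> cmod z = 1" using Suc.prems q by auto
    ultimately show ?thesis using Suc.hyps(1)[of q j] by simp
  qed
  have c: "coeff p k = (case k of 0 \<Rightarrow> 0 | Suc j \<Rightarrow> coeff q j) - z * coeff q k"
    unfolding q by (simp add: coeff_pCons split: nat.split)
  have "cmod (coeff p k) \<le> cmod (case k of 0 \<Rightarrow> 0 | Suc j \<Rightarrow> coeff q j) + cmod (z * coeff q k)"
    unfolding c by (rule norm_triangle_ineq4)
  also have "\<dots> \<le> cmod (lead_coeff q) * 2 ^ n + cmod (lead_coeff q) * 2 ^ n"
    using IH Suc.prems[OF z] by (intro add_mono) (auto simp: norm_mult split: nat.split)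
  also have "\<dots> = cmod (lead_coeff p) * 2 ^ degree p" using lq dq Suc by simp
  finally show ?case .
qed

text \<open>
  The primitive integer polynomial of least degree divides \<open>X\<^sup>N - 1\<close> by Gauss' lemma, so it is monic up to
  sign with all roots on the unit circle.
\<close>
lemma root_of_unity_bounded_poly:
  assumes N: "N > 0" "z ^ N = (1::complex)"
    and q0: "q0 \<noteq> 0" "degree q0 \<le> D" "poly (map_poly of_int (q0::int poly)) z = 0"
  shows "\<exists>q::int poly. q \<noteq> 0 \<and> degree q \<le> D \<and> (\<forall>k. \<bar>coeff q k\<bar> \<le> 2 ^ D) \<and> poly (map_poly of_int q) z = 0"
proof -
  let ?P = "\<lambda>q::int poly. q \<noteq> 0 \<and> poly (map_poly of_int q) z = 0"
  obtain q1 where q1: "?P q1" "\<And>r. ?P r \<Longrightarrow> degree q1 \<le> degree r"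
    using ex_has_least_nat[of ?P q0 degree] q0 by blast
  define q where "q = primitive_part q1"
  have cq: "content q = 1" using q1 by (simp add: q_def)
  have q1q: "q1 = smult (content q1) q" by (simp add: q_def)
  have qz: "poly (map_poly of_int q) z = 0"
  proof -
    have "of_int (content q1) * poly (map_poly of_int q) z = 0"
      using conjunct2[OF q1(1)] by (subst (asm) q1q) (simp only: map_poly_of_int_smult poly_smult)
    then show ?thesis using q1 by auto
  qed
  have qn0: "q \<noteq> 0" using cq by auto
  have dq: "degree q = degree q1" by (simp add: q_def)
  define f where "f = monom (1::int) N - 1"
  have fz: "poly (map_poly of_int f) w = w ^ N - 1" for w :: complex
  proof -
    have "map_poly of_int f = monom (1::complex) N - 1"
      unfolding f_def by (rule poly_eqI) (simp add: coeff_map_poly)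
    then show ?thesis by (simp add: poly_monom)
  qed
  have df: "degree f = N \<and> lead_coeff f = 1"
  proof -
    have "degree f = N"
    proof (rule antisym)
      show "degree f \<le> N" using N by (intro degree_le) (auto simp: f_def)
      show "N \<le> degree f" using N by (intro le_degree) (auto simp: f_def)
    qed
    then show ?thesis using N by (simp add: f_def)
  qed
  obtain a s where as: "a \<noteq> 0" "smult a f = q * s + pseudo_mod f q"
    using pseudo_mod(1)[OF qn0, of f] by blast
  have "pseudo_mod f q = 0"
  proof (rule ccontr)
    assume r: "pseudo_mod f q \<noteq> 0"
    have "poly (map_poly of_int (smult a f)) z = 0" using fz[of z] N by (simp add: map_poly_of_int_smult)
    then have "poly (map_poly of_int (pseudo_mod f q)) z = 0"
      unfolding as(2) by (simp add: map_poly_of_int_add map_poly_of_int_mult qz)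
    then have "degree q \<le> degree (pseudo_mod f q)" using q1(2) r dq by auto
    then show False using pseudo_mod(2)[OF qn0, of f] r by auto
  qed
  then have as2: "smult a f = q * s" using as by simp
  have "content f dvd 1" using content_dvd_coeff[of f "degree f"] df by metis
  then have "content f = 1" by (metis is_unit_content_iff)
  \<comment> \<open>Both \<open>f\<close> and \<open>q\<close> are primitive, so the factor
    \<open>a\<close> introduced by pseudo-division sits entirely in \<open>s\<close> and can be
    cancelled, leaving a factorization over the integers.\<close>
  then have "normalize a = content s"
    using arg_cong[OF as2, of content] cq by (simp add: content_mult)
  then have "a dvd content s" by (metis dvd_refl normalize_dvd_iff)
  then obtain s' where "s = smult a s'"
    by (metis const_poly_dvd_iff_dvd_content dvdE mult_pCons_left mult_zero_left add_0_right pCons_0_0)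
  then have "smult a f = smult a (q * s')" using as2 by simp
  then have fq: "f = q * s'" using as(1) by (metis smult_cancel)
  have "lead_coeff q * lead_coeff s' = 1" using df fq by (metis lead_coeff_mult)
  then have lq: "\<bar>lead_coeff q\<bar> = 1" by (metis abs_zmult_eq_1 abs_one)
  have roots: "cmod w = 1" if "poly (map_poly of_int q) w = 0" for w :: complex
  proof -
    have "poly (map_poly of_int f) w = 0" unfolding fq using that by (simp add: map_poly_of_int_mult)
    then have "w ^ N = 1" using fz by simp
    then show ?thesis using N by (metis norm_one norm_power power_eq_1_iff norm_ge_zero not_gr_zero)
  qed
  have "\<bar>coeff q k\<bar> \<le> 2 ^ D" for k
  proof -
    have "cmod (coeff (map_poly of_int q) k) \<le> cmod (lead_coeff (map_poly of_int q :: complex poly)) * 2 ^ degree q"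
      using coeff_bound_unit_roots[of "map_poly of_int q" k] roots degree_map_poly_of_int by simp
    also have "lead_coeff (map_poly of_int q :: complex poly) = of_int (lead_coeff q)"
      by (simp add: degree_map_poly_of_int coeff_map_poly)
    finally have "real_of_int \<bar>coeff q k\<bar> \<le> of_int \<bar>lead_coeff q\<bar> * 2 ^ degree q"
      by (simp add: coeff_map_poly)
    also have "\<dots> = of_int (2 ^ degree q)" using lq by simp
    finally have "\<bar>coeff q k\<bar> \<le> 2 ^ degree q" by linarith
    also have "\<dots> \<le> 2 ^ D" using dq q1(2)[of q0] q0 by (intro power_increasing) auto
    finally show ?thesis .
  qed
  moreover have "degree q \<le> D" using dq q1(2)[of q0] q0 by auto
  ultimately show ?thesis using qn0 qz by blast
qed

lemma finite_bounded_int_polys: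
  "finite {q::int poly. degree q \<le> D \<and> (\<forall>k. \<bar>coeff q k\<bar> \<le> M)}" (is "finite ?S")
proof -
  have "coeffs ` ?S \<subseteq> {xs. set xs \<subseteq> {-M..M} \<and> length xs \<le> Suc D}"
  proof (clarsimp, intro conjI subsetI)
    fix q :: "int poly" and c assume "\<forall>k. \<bar>coeff q k\<bar> \<le> M" "c \<in> set (coeffs q)"
    then show "c \<in> {-M..M}" by (auto simp: coeffs_def abs_le_iff minus_le_iff split: if_splits)
  qed (auto simp: coeffs_def)
  moreover have "finite {xs. set xs \<subseteq> {-M..M} \<and> length xs \<le> Suc D}"
    by (intro finite_lists_length_le) auto
  ultimately have "finite (coeffs ` ?S)" by (rule finite_subset)
  then show ?thesis by (rule finite_imageD) (auto simp: inj_on_def coeffs_eq_iff)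
qed

text \<open>The bounds on degree and coefficients depend on \<open>card B\<close> only and not on
  the order \<open>N\<close>, so finitely many nonzero polynomials capture all these roots of
  unity.\<close>

lemma finite_roots_of_unity_fin_subalg:
  assumes A: "fin_subalg A"
  shows "finite {z \<in> A. \<exists>N>0. z ^ N = 1}"
proof -
  obtain B where B: "finite B" "A = rat_vs.span B" using A fin_subalg_def by auto
  define D where "D = card B"
  let ?Q = "{q::int poly. degree q \<le> D \<and> (\<forall>k. \<bar>coeff q k\<bar> \<le> 2 ^ D)} - {0}"
  have "{z \<in> A. \<exists>N>0. z ^ N = 1} \<subseteq> (\<Union>q\<in>?Q. {z. poly (map_poly of_int q) z = 0})"
  proof
    fix z assume "z \<in> {z \<in> A. \<exists>N>0. z ^ N = 1}"
    then obtain N where z: "z \<in> A" "N > 0" "z ^ N = 1" by auto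
    obtain q0 :: "int poly" where "q0 \<noteq> 0" "degree q0 \<le> D" "poly (map_poly of_int q0) z = 0"
      using int_poly_of_powers_in_span[of B z] B fin_subalgD(9)[OF A z(1)] D_def by auto
    from root_of_unity_bounded_poly[OF z(2,3) this]
    show "z \<in> (\<Union>q\<in>?Q. {z. poly (map_poly of_int q) z = 0})" by blast
  qed
  moreover have "finite (\<Union>q\<in>?Q. {z::complex. poly (map_poly of_int q) z = 0})"
    using finite_bounded_int_polys by (auto intro!: poly_roots_finite simp: map_poly_of_int_eq_0_iff)
  ultimately show ?thesis by (rule finite_subset)
qed

section \<open>Billiards in a simple polygon\<close>

locale simple_poly =
  fixes v :: "nat \<Rightarrow> complex" and d :: nat
  assumes simple: "simple_polygon v d"
begin

abbreviation tang :: "nat \<Rightarrow> complex" where "tang \<equiv> unit_tan v d"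
abbreviation len :: "nat \<Rightarrow> real" where "len \<equiv> side_len v d"
abbreviation cm :: "nat \<Rightarrow> real" where "cm \<equiv> cum v d"
abbreviation sd :: "real \<Rightarrow> nat" where "sd \<equiv> side_of v d"

definition pt :: "nat \<Rightarrow> real \<Rightarrow> complex" where
  "pt i r = v i + of_real r * tang i"

lemma nxt_less: "nxt d i < d"
  using simple by (auto simp: simple_polygon_def nxt_def)

lemma len_pos: "i < d \<Longrightarrow> len i > 0"
  using simple by (auto simp: simple_polygon_def side_len_def)

lemma norm_tang: "i < d \<Longrightarrow> cmod (tang i) = 1"
  using len_pos[of i] by (auto simp: unit_tan_def norm_divide side_len_def)

lemma tang_nz: "i < d \<Longrightarrow> tang i \<noteq> 0"
  using norm_tang by force

lemma tang_cnj: "i < d \<Longrightarrow> tang i * cnj (tang i) = 1"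
  using norm_tang by (simp add: complex_norm_square[symmetric])

lemma pt_len: "i < d \<Longrightarrow> pt i (len i) = v (nxt d i)"
  using len_pos[of i] by (auto simp: pt_def unit_tan_def)

lemma pt_0: "pt i 0 = v i"
  by (simp add: pt_def)

lemma pt_eq_iff: "i < d \<Longrightarrow> pt i r = pt i r' \<longleftrightarrow> r = r'"
  using tang_nz by (auto simp: pt_def)

lemma side_eq: "i < d \<Longrightarrow> side v d i = pt i ` {0..len i}"
proof -
  assume i: "i < d"
  have e: "v (nxt d i) = v i + of_real (len i) * tang i" using pt_len[OF i] by (simp add: pt_def)
  show ?thesis
  proof (intro set_eqI iffI)
    fix z assume "z \<in> side v d i"
    then obtain u where u: "0 \<le> u" "u \<le> 1" "z = (1 - u) *\<^sub>R v i + u *\<^sub>R v (nxt d i)"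
      by (auto simp: side_def closed_segment_def)
    then have "z = pt i (u * len i)" unfolding e pt_def by (simp add: scaleR_conv_of_real algebra_simps)
    moreover have "u * len i \<in> {0..len i}" using u len_pos[OF i] by (auto intro: mult_left_le_one_le)
    ultimately show "z \<in> pt i ` {0..len i}" by blast
  next
    fix z assume "z \<in> pt i ` {0..len i}"
    then obtain r where r: "0 \<le> r" "r \<le> len i" "z = pt i r" by auto
    define u where "u = r / len i"
    have "r = u * len i" using len_pos[OF i] by (simp add: u_def)
    then have "z = (1 - u) *\<^sub>R v i + u *\<^sub>R v (nxt d i)"
      unfolding e r(3) pt_def by (simp add: scaleR_conv_of_real algebra_simps)
    moreover have "0 \<le> u" "u \<le> 1" using r len_pos[OF i] by (auto simp: u_def)
    ultimately show "z \<in> side v d i" by (auto simp: side_def closed_segment_def)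
  qed
qed

text \<open>Distinct sides of a simple polygon share at most a vertex, and the vertices of side
  \<open>i\<close> sit at \<open>r = 0\<close> and \<open>r = len i\<close>.\<close>

lemma sides_meet:
  assumes "i < d" "j < d" "0 < r" "r < len i" "pt i r \<in> side v d j"
  shows "i = j"
proof (rule ccontr)
  assume ne: "i \<noteq> j"
  have "pt i r \<in> side v d i" using assms by (auto simp: side_eq)
  then have "pt i r \<in> side v d i \<inter> side v d j" using assms by auto
  also have "\<dots> = (if j = nxt d i then {v j} else if i = nxt d j then {v i} else {})"
    using simple assms ne unfolding simple_polygon_def by blast
  finally have "pt i r = pt i (len i) \<or> pt i r = pt i 0"
    using assms by (auto simp: pt_len pt_0 split: if_splits)
  then show False using assms pt_eq_iff by auto
qed

lemma pt_not_vertex: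
  assumes "i < d" "0 < r" "r < len i" "j < d"
  shows "pt i r \<noteq> v j"
proof
  assume e: "pt i r = v j"
  have "v j \<in> side v d j" by (auto simp: side_def)
  then have "i = j" using sides_meet[of i j r] assms e by auto
  then show False using e pt_eq_iff[of i r 0] assms pt_0 by auto
qed

section \<open>Arc length versus side and offset\<close>

lemma cum_Suc: "cm (Suc i) = cm i + len i"
  by (simp add: cum_def)

lemma cum_mono: "i \<le> j \<Longrightarrow> j \<le> d \<Longrightarrow> cm i \<le> cm j"
  unfolding cum_def using len_pos by (intro sum_mono2) (auto intro: less_imp_le)

lemma cum_nonneg: "i \<le> d \<Longrightarrow> 0 \<le> cm i"
  using cum_mono[of 0 i] by (simp add: cum_def)

lemma side_of_eq:
  assumes "i < d" "cm i < s" "s < cm (Suc i)"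
  shows "sd s = i"
  unfolding side_of_def
proof (rule the_equality)
  fix j assume j: "j < d \<and> cm j < s \<and> s < cm (Suc j)"
  show "j = i"
  proof (rule ccontr)
    assume "j \<noteq> i"
    then have "Suc j \<le> i \<or> Suc i \<le> j" by auto
    then show False using cum_mono[of "Suc j" i] cum_mono[of "Suc i" j] assms j by auto
  qed
qed (use assms in auto)

lemma valid_pos_iff: "valid_pos v d s \<longleftrightarrow> (\<exists>i<d. cm i < s \<and> s < cm (Suc i))"
proof
  assume vp: "valid_pos v d s"
  have "n \<le> d \<Longrightarrow> s < cm n \<Longrightarrow> \<exists>i<n. cm i < s \<and> s < cm (Suc i)" for n
  proof (induction n)
    case 0
    then show ?case using vp by (simp add: valid_pos_def cum_def)
  next
    case (Suc n)
    show ?case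
    proof (cases "s < cm n")
      case True
      then show ?thesis using Suc less_SucI by (metis Suc_leD)
    next
      case False
      moreover have "s \<noteq> cm n" using vp Suc by (auto simp: valid_pos_def)
      ultimately show ?thesis using Suc by (intro exI[of _ n]) auto
    qed
  qed
  then show "\<exists>i<d. cm i < s \<and> s < cm (Suc i)" using vp by (auto simp: valid_pos_def perim_def)
next
  assume "\<exists>i<d. cm i < s \<and> s < cm (Suc i)"
  then obtain i where i: "i < d" "cm i < s" "s < cm (Suc i)" by auto
  have "s \<noteq> cm j" if "j < d" for j
  proof
    assume "s = cm j"
    moreover have "j \<le> i \<or> Suc i \<le> j" by auto
    ultimately show False using i that cum_mono[of j i] cum_mono[of "Suc i" j] by auto
  qed
  moreover have "0 \<le> s" "s < perim v d"
    using i cum_nonneg[of i] cum_mono[of "Suc i" d] by (auto simp: perim_def)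
  ultimately show "valid_pos v d s" by (auto simp: valid_pos_def)
qed

definition off :: "real \<Rightarrow> real" where
  "off s = s - cm (sd s)"

lemma valid_posD:
  assumes "valid_pos v d s"
  shows "sd s < d" "0 < off s" "off s < len (sd s)" "bpt v d s = pt (sd s) (off s)"
proof -
  obtain i where i: "i < d" "cm i < s" "s < cm (Suc i)" using assms valid_pos_iff by auto
  moreover have "sd s = i" using i by (rule side_of_eq)
  ultimately show "sd s < d" "0 < off s" "off s < len (sd s)" by (auto simp: cum_Suc off_def)
  show "bpt v d s = pt (sd s) (off s)" by (simp add: bpt_def pt_def off_def Let_def)
qed

lemma valid_posI:
  assumes "i < d" "0 < r" "r < len i"
  shows "valid_pos v d (cm i + r)" "sd (cm i + r) = i" "off (cm i + r) = r"
    "bpt v d (cm i + r) = pt i r"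
proof -
  have b: "cm i < cm i + r" "cm i + r < cm (Suc i)" using assms by (auto simp: cum_Suc)
  then show vp: "valid_pos v d (cm i + r)" and s: "sd (cm i + r) = i"
    using assms valid_pos_iff side_of_eq by blast+
  then show "off (cm i + r) = r" by (simp add: off_def)
  then show "bpt v d (cm i + r) = pt i r" using valid_posD(4)[OF vp] s by simp
qed

lemma bpt_inj:
  assumes "valid_pos v d s" "valid_pos v d s'" "bpt v d s = bpt v d s'"
  shows "s = s'"
proof -
  note a = valid_posD[OF assms(1)] and b = valid_posD[OF assms(2)]
  have e: "pt (sd s) (off s) = pt (sd s') (off s')" using a b assms by simp
  also have "\<dots> \<in> side v d (sd s')" using b by (auto simp: side_eq)
  finally have "sd s = sd s'" using sides_meet a b by blast
  then show ?thesis using e pt_eq_iff a b by (auto simp: off_def)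
qed

lemma bpt_on_boundary: "valid_pos v d s \<Longrightarrow> on_boundary v d (bpt v d s)"
  using valid_posD[of s] by (auto simp: on_boundary_def side_eq intro!: exI[of _ "sd s"])

text \<open>Of two different hitting times the smaller one would be a boundary contact before the
  larger one. This gives meaning to the \<open>THE\<close> in \<open>pinball\<close>.\<close>

lemma hits_unique:
  assumes "hits v d x s" "hits v d x s'"
  shows "s = s'"
proof -
  let ?f = "\<lambda>t. bpt v d (fst x) + complex_of_real t * out_dir v d x"
  obtain t where t: "t > 0" "bpt v d s = ?f t" "\<And>t'. 0 < t' \<Longrightarrow> t' < t \<Longrightarrow> \<not> on_boundary v d (?f t')"
    using assms(1) unfolding hits_def by blast
  obtain t' where t': "t' > 0" "bpt v d s' = ?f t'" "\<And>t''. 0 < t'' \<Longrightarrow> t'' < t' \<Longrightarrow> \<not> on_boundary v d (?f t'')"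
    using assms(2) unfolding hits_def by blast
  have "on_boundary v d (?f t)" "on_boundary v d (?f t')"
    using assms bpt_on_boundary t t' unfolding hits_def by metis+
  then have "t = t'" using t t' by (metis linorder_cases)
  then show ?thesis using bpt_inj assms t t' by (auto simp: hits_def)
qed

text \<open>Turns the partial map into a relation. The argument of \<open>Arg\<close> is the
  reflected direction divided by the inward normal, simplified with \<open>out_dir\<close> written
  out.\<close>

lemma pinball_eq_Some_iff:
  "pinball v d lam x = Some y \<longleftrightarrow> hits v d x (fst y) \<and> valid_state v d y \<and>
     snd y = lam * Arg (- tang (sd (fst y)) * cnj (tang (sd (fst x))) * cis (- snd x))"
proof -
  have A: "(tang (sd s))\<^sup>2 * cnj (out_dir v d x) / inward_normal v d (sd s) =
      - tang (sd s) * cnj (tang (sd (fst x))) * cis (- snd x)" if "hits v d x s" for s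
  proof -
    have "sd s < d" using that valid_posD by (auto simp: hits_def)
    then show ?thesis
      using tang_nz by (simp add: out_dir_def inward_normal_def cis_cnj power2_eq_square field_simps)
  qed
  have B: "(THE s'. hits v d x s') = s" if "hits v d x s" for s
    using that hits_unique by blast
  show ?thesis
  proof (cases "\<exists>s'. hits v d x s'")
    case True
    then obtain s where s: "hits v d x s" by blast
    let ?y = "(s, lam * Arg (- tang (sd s) * cnj (tang (sd (fst x))) * cis (- snd x)))"
    have e: "pinball v d lam x = (if valid_state v d ?y then Some ?y else None)"
      using True unfolding pinball_def Let_def B[OF s] A[OF s] by (simp only: if_True)
    have u: "hits v d x s' \<longleftrightarrow> s' = s" for s' using s hits_unique by blast
    show ?thesis unfolding e u by (cases y) auto
  next
    case False
    then show ?thesis by (auto simp: pinball_def)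
  qed
qed

section \<open>Orbits as total periodic sequences\<close>

lemma orb_Suc: "orb v d lam x (Suc k) = Option.bind (orb v d lam x k) (pinball v d lam)"
  by (simp add: orb_def)

lemma orb_0: "orb v d lam x 0 = Some x"
  by (simp add: orb_def)

lemma orb_add: "orb v d lam x (m + k) = Option.bind (orb v d lam x m) (\<lambda>y. orb v d lam y k)"
proof (induction k)
  case 0
  then show ?case by (cases "orb v d lam x m") (auto simp: orb_0)
next
  case (Suc k)
  then show ?case by (cases "orb v d lam x m") (auto simp: orb_Suc)
qed

definition is_orbit :: "real \<Rightarrow> (nat \<Rightarrow> real \<times> real) \<Rightarrow> bool" where
  "is_orbit lam z \<longleftrightarrow> (\<forall>k. pinball v d lam (z k) = Some (z (Suc k)))"

lemma is_orbit_orb: "is_orbit lam z \<Longrightarrow> orb v d lam (z k) m = Some (z (k + m))"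
  by (induction m) (auto simp: orb_0 orb_Suc is_orbit_def)

lemma is_orbit_valid: "is_orbit lam z \<Longrightarrow> valid_state v d (z k)"
  by (auto simp: is_orbit_def pinball_eq_Some_iff hits_def)

lemma is_orbit_itin: "is_orbit lam z \<Longrightarrow> itin v d lam (z k) = (\<lambda>m. sd (fst (z (k + m))))"
  by (auto simp: itin_def is_orbit_orb)

lemma is_orbit_shift: "is_orbit lam z \<Longrightarrow> is_orbit lam (\<lambda>k. z (m + k))"
  by (auto simp: is_orbit_def)

lemma periodic_mult:
  fixes z :: "nat \<Rightarrow> 'a"
  assumes "\<And>k. z (k + p) = z k"
  shows "z (k + n * p) = z k"
proof (induction n)
  case (Suc n)
  have "z (k + Suc n * p) = z ((k + n * p) + p)" by (simp add: algebra_simps)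
  then show ?case using Suc assms by simp
qed auto

lemma is_orbit_periodic:
  assumes "is_orbit lam z" "p > 0" "\<And>k. z (k + p) = z k"
  shows "periodic_pt v d lam (z k)"
  unfolding periodic_pt_def using is_orbit_valid[OF assms(1)] is_orbit_orb[OF assms(1), of k p] assms by auto

lemma periodic_ptE:
  assumes "periodic_pt v d lam x"
  obtains z p where "p > 0" "even p" "z 0 = x" "is_orbit lam z" "\<And>k. z (k + p) = z k"
proof -
  obtain q where q: "q > 0" "orb v d lam x q = Some x" using assms by (auto simp: periodic_pt_def)
  have *: "orb v d lam x (k + q) = orb v d lam x k" for k
    using q orb_add[of lam x q k] by (simp add: add.commute)
  \<comment> \<open>An orbit undefined at time \<open>k\<close> would stay undefined at the later
    time \<open>k * q\<close>, where it is back at \<open>x\<close>.\<close>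
  have "orb v d lam x k \<noteq> None" for k
  proof
    assume n: "orb v d lam x k = None"
    have "orb v d lam x (0 + k * q) = orb v d lam x 0"
      by (rule periodic_mult[where z = "\<lambda>k. orb v d lam x k"]) (rule *)
    then have "orb v d lam x (k * q) = Some x" by (simp add: orb_0)
    moreover have "k * q = k + (k * q - k)" using q by simp
    ultimately have "Some x = Option.bind (orb v d lam x k) (\<lambda>y. orb v d lam y (k * q - k))"
      using orb_add[of lam x k "k * q - k"] by metis
    then show False using n by simp
  qed
  then have S: "orb v d lam x k = Some (the (orb v d lam x k))" for k by auto
  define z where "z = (\<lambda>k. the (orb v d lam x k))"
  have zp: "z (k + q) = z k" for k using * by (simp add: z_def)
  have "is_orbit lam z"
    unfolding is_orbit_def
  proof
    fix k
    have "orb v d lam x (Suc k) = pinball v d lam (z k)"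
      using S[of k] by (cases "orb v d lam x k") (auto simp: orb_Suc z_def)
    then show "pinball v d lam (z k) = Some (z (Suc k))" using S[of "Suc k"] z_def by simp
  qed
  moreover have "z 0 = x" by (simp add: z_def orb_0)
  \<comment> \<open>The period is doubled to make the number of reflections even: the signs
    \<open>(-1) ^ k\<close> become periodic and the unfolding over a period preserves
    orientation.\<close>
  moreover have "z (k + 2 * q) = z k" for k using periodic_mult[of z q k 2] zp by simp
  ultimately show ?thesis using that[of "2 * q" z] q by auto
qed

end

section \<open>Parallel families of periodic orbits\<close>

lemma affine_zero_between:
  fixes a b c :: real
  assumes "a > 0" "a + c * b \<le> 0" "c \<ge> 0"
  shows "\<exists>r. 0 \<le> r \<and> r \<le> c \<and> a + r * b = 0"
proof -
  have b: "b < 0"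
  proof (rule ccontr)
    assume "\<not> b < 0"
    then have "c * b \<ge> 0" using assms by simp
    then show False using assms by simp
  qed
  then show ?thesis using assms
    by (intro exI[of _ "- a / b"]) (auto simp: field_simps)
qed

text \<open>
  A strip of parallel segments \<open>[P h', P h' + t h' u]\<close>, \<open>h \<le> h' \<le> 0\<close>: follow the obstacle from a
  point of the last segment towards an endpoint in the direction of increasing \<open>h'\<close>. It cannot
  leave the strip through the lateral edges, so either the endpoint is in the strip, or the
  obstacle meets the first segment.
\<close>
lemma strip_free:
  fixes P0 A u w1 w2 :: complex and tc b h s :: real
  defines "P \<equiv> \<lambda>h. P0 + of_real h * A" and "t \<equiv> \<lambda>h. tc + h * b"
  assumes D: "Im (A / u) \<noteq> 0" and h: "h \<le> 0"
    and vert: "\<And>h' s w. h \<le> h' \<Longrightarrow> h' \<le> 0 \<Longrightarrow> 0 \<le> s \<Longrightarrow> s \<le> t h' \<Longrightarrow> w \<in> {w1, w2} \<Longrightarrow>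
                 P h' + of_real s * u \<noteq> w"
    and latP: "\<And>h'. h \<le> h' \<Longrightarrow> h' \<le> 0 \<Longrightarrow> P h' \<in> closed_segment w1 w2 \<Longrightarrow>
                 \<forall>q\<in>closed_segment w1 w2. \<exists>h''. q = P h''"
    and latQ: "\<And>h'. h \<le> h' \<Longrightarrow> h' \<le> 0 \<Longrightarrow> P h' + of_real (t h') * u \<in> closed_segment w1 w2 \<Longrightarrow>
                 \<forall>q\<in>closed_segment w1 w2. \<exists>h''. q = P h'' + of_real (t h'') * u"
    and free: "\<And>s. 0 < s \<Longrightarrow> s < t 0 \<Longrightarrow> P 0 + of_real s * u \<notin> closed_segment w1 w2"
    and s: "0 < s" "s < t h"
  shows "P h + of_real s * u \<notin> closed_segment w1 w2"
proof
  let ?S = "closed_segment w1 w2"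
  assume q: "P h + of_real s * u \<in> ?S"
  define q where "q = P h + of_real s * u"
  have u0: "u \<noteq> 0" using D by auto
  \<comment> \<open>Affine coordinates of the strip: \<open>X\<close> is the parameter of the
    segment whose line contains the point, \<open>f\<close> the distance from the edge
    \<open>P\<close> along \<open>u\<close>, and \<open>g\<close> what then remains up to the
    opposite edge.\<close>
  define X where "X = (\<lambda>w. Im ((w - P0) / u) / Im (A / u))"
  define f where "f = (\<lambda>w. Re ((w - P0) / u) - X w * Re (A / u))"
  define g where "g = (\<lambda>w. t (X w) - f w)"
  have quot: "(P h' + of_real s * u - P0) / u = of_real h' * (A / u) + of_real s" for h' s
    using u0 by (simp add: P_def field_simps)
  have XP: "X (P h' + of_real s * u) = h'" for h' s
    unfolding X_def quot using D by (simp del: times_divide_eq_right)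
  have fP: "f (P h' + of_real s * u) = s" for h' s
    unfolding f_def XP quot by (simp del: times_divide_eq_right)
  have rep: "w = P (X w) + of_real (f w) * u" for w
  proof -
    have "(w - P0) / u = of_real (X w) * (A / u) + of_real (f w)"
      using D by (intro complex_eqI) (simp_all add: X_def f_def del: times_divide_eq_right)
    then have "w - P0 = of_real (X w) * A + of_real (f w) * u"
      using u0 by (simp add: field_simps)
    then show ?thesis by (simp add: P_def algebra_simps)
  qed
  have quot2: "(y + of_real r * (w - y) - P0) / u = (y - P0) / u + of_real r * ((w - P0) / u - (y - P0) / u)"
    for y w r using u0 by (simp add: field_simps)
  have ImL: "Im (a + of_real r * (b - a)) = Im a + r * (Im b - Im a)"
    and ReL: "Re (a + of_real r * (b - a)) = Re a + r * (Re b - Re a)" for a b r by simp_all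
  have lin: "(a + r * (b - a)) / c = a / c + r * (b / c - a / c)" for a b c r :: real
    by (simp add: add_divide_distrib diff_divide_distrib right_diff_distrib)
  have Xa: "X (y + of_real r * (w - y)) = X y + r * (X w - X y)" for y w r
    unfolding X_def quot2 ImL lin ..
  have fa: "f (y + of_real r * (w - y)) = f y + r * (f w - f y)" for y w r
    unfolding f_def Xa quot2 ReL by (simp add: algebra_simps)
  have ga: "g (y + of_real r * (w - y)) = g y + r * (g w - g y)" for y w r
    unfolding g_def Xa fa t_def by (simp add: algebra_simps)
  have Xq: "X q = h" and fq: "f q > 0" and gq: "g q > 0"
    using XP fP s by (auto simp: q_def g_def)
  obtain w where w: "w \<in> {w1, w2}" "X w \<ge> h"
  proof -
    obtain m where m: "0 \<le> m" "m \<le> 1" "q = (1 - m) *\<^sub>R w1 + m *\<^sub>R w2"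
      using q unfolding q_def closed_segment_def by auto
    have "q = w1 + of_real m * (w2 - w1)" unfolding m by (simp add: scaleR_conv_of_real algebra_simps)
    then have e: "h = X w1 + m * (X w2 - X w1)" using Xa Xq by simp
    have "X w1 \<ge> h \<or> X w2 \<ge> h"
    proof (rule ccontr)
      assume "\<not> ?thesis"
      then have "(1 - m) * X w1 + m * X w2 < h" using m by (intro convex_bound_lt) auto
      then show False using e by (simp add: algebra_simps)
    qed
    then show ?thesis using that by auto
  qed
  define e where "e = (\<lambda>r::real. q + of_real r * (w - q))"
  have eS: "e r \<in> ?S" if "0 \<le> r" "r \<le> 1" for r
  proof -
    have "e r = (1 - r) *\<^sub>R q + r *\<^sub>R w" by (simp add: e_def scaleR_conv_of_real algebra_simps)
    moreover have "q \<in> ?S" "w \<in> ?S" using q w by (auto simp: q_def)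
    ultimately show ?thesis
      using convexD[OF convex_closed_segment, of q w1 w2 w "1 - r" r] that by auto
  qed
  \<comment> \<open>The walk from \<open>q\<close> to \<open>w\<close> stops at \<open>w\<close>, or
    earlier where \<open>X\<close> reaches 0; solving \<open>h + r * (X w - h) = 0\<close> gives the
    second value.\<close>
  define r1 where "r1 = (if X w \<le> 0 then 1 else - h / (X w - h))"
  have r1: "0 \<le> r1" "r1 \<le> 1" using h w(2) by (auto simp: r1_def divide_simps)
  have Xr1: "X (e r1) \<le> 0" using h by (auto simp: e_def Xa Xq r1_def)
  have Xe: "h \<le> X (e r)" "X (e r) \<le> 0" if "0 \<le> r" "r \<le> r1" for r
  proof -
    have "r * (X w - h) \<ge> 0" "r * (X w - h) \<le> r1 * (X w - h)"
      using w that by (auto intro: mult_right_mono)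
    then show "h \<le> X (e r)" "X (e r) \<le> 0" using Xr1 by (auto simp: e_def Xa Xq)
  qed
  \<comment> \<open>A zero of \<open>f\<close> on the way is a point of the obstacle on the lateral
    edge; \<open>latP\<close> then puts the whole obstacle, including \<open>q\<close>, on that
    line, where \<open>f\<close> vanishes. The same argument with \<open>latQ\<close> serves for
    \<open>g\<close>.\<close>
  have f1: "f (e r1) > 0"
  proof (rule ccontr)
    assume "\<not> f (e r1) > 0"
    then obtain r where r: "0 \<le> r" "r \<le> r1" "f q + r * (f w - f q) = 0"
      using affine_zero_between[of "f q" r1 "f w - f q"] fq r1 by (auto simp: e_def fa)
    then have "e r = P (X (e r))" using rep[of "e r"] by (simp add: e_def fa)
    then obtain h'' where "q = P h''"
      using latP[OF Xe[OF r(1,2)]] eS[of r] r r1 q by (auto simp: q_def)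
    then show False using fP[of h'' 0] fq by simp
  qed
  have g1: "g (e r1) > 0"
  proof (rule ccontr)
    assume "\<not> g (e r1) > 0"
    then obtain r where r: "0 \<le> r" "r \<le> r1" "g q + r * (g w - g q) = 0"
      using affine_zero_between[of "g q" r1 "g w - g q"] gq r1 by (auto simp: e_def ga)
    then have "g (e r) = 0" by (simp add: e_def ga)
    then have "e r = P (X (e r)) + of_real (t (X (e r))) * u" using rep[of "e r"] by (simp add: g_def)
    then obtain h'' where "q = P h'' + of_real (t h'') * u"
      using latQ[OF Xe[OF r(1,2)]] eS[of r] r r1 q by (auto simp: q_def)
    then have "g q = 0" using fP XP by (simp add: g_def)
    then show False using gq by simp
  qed
  have er1: "e r1 = P (X (e r1)) + of_real (f (e r1)) * u" by (rule rep)
  show False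
  proof (cases "X w \<le> 0")
    case True
    then have "e r1 = w" by (simp add: e_def r1_def)
    then show False using vert[OF Xe[OF r1(1)], of "f (e r1)" w] f1 g1 er1 w by (auto simp: g_def)
  next
    case False
    then have "X (e r1) = 0" unfolding e_def Xa Xq using h by (simp add: r1_def)
    then show False using free[of "f (e r1)"] f1 g1 er1 eS[OF r1] by (auto simp: g_def)
  qed
qed

locale billiard_orbit = simple_poly +
  fixes z :: "nat \<Rightarrow> real \<times> real" and p :: nat
  assumes orbit: "is_orbit 1 z" and p: "p > 0" "even p" and zp: "\<And>k. z (k + p) = z k"
begin

definition I :: "nat \<Rightarrow> nat" where "I k = sd (fst (z k))"
definition th :: "nat \<Rightarrow> real" where "th k = snd (z k)"
definition R :: "nat \<Rightarrow> real" where "R k = off (fst (z k))"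
definition U :: "nat \<Rightarrow> complex" where "U k = \<i> * tang (I k) * cis (th k)"
definition T :: "nat \<Rightarrow> real" where "T k = cmod (pt (I (Suc k)) (R (Suc k)) - pt (I k) (R k))"

lemma valid_z: "I k < d" "0 < R k" "R k < len (I k)" "- (pi/2) < th k" "th k < pi/2"
  "bpt v d (fst (z k)) = pt (I k) (R k)"
  using is_orbit_valid[OF orbit, of k] valid_posD[of "fst (z k)"]
  by (auto simp: valid_state_def I_def R_def th_def)

lemma out_dir_z: "out_dir v d (z k) = U k"
  by (simp add: out_dir_def U_def I_def th_def inward_normal_def)

lemma norm_U: "cmod (U k) = 1"
  using norm_tang valid_z by (simp add: U_def norm_mult)

lemma U_nz: "U k \<noteq> 0"
  using norm_U[of k] by auto

lemma cos_th: "cos (th k) > 0"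
  using valid_z[of k] cos_gt_zero_pi by auto

lemma step: "T k > 0" "pt (I (Suc k)) (R (Suc k)) = pt (I k) (R k) + of_real (T k) * U k"
  "0 < t' \<Longrightarrow> t' < T k \<Longrightarrow> \<not> on_boundary v d (pt (I k) (R k) + of_real t' * U k)"
proof -
  have "hits v d (z k) (fst (z (Suc k)))" using orbit by (auto simp: is_orbit_def pinball_eq_Some_iff)
  then obtain t where t: "t > 0" "bpt v d (fst (z (Suc k))) = bpt v d (fst (z k)) + of_real t * out_dir v d (z k)"
     "\<And>t'. 0 < t' \<Longrightarrow> t' < t \<Longrightarrow> \<not> on_boundary v d (bpt v d (fst (z k)) + of_real t' * out_dir v d (z k))"
    unfolding hits_def by blast
  then have e: "pt (I (Suc k)) (R (Suc k)) = pt (I k) (R k) + of_real t * U k"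
    by (simp add: valid_z out_dir_z)
  then have "T k = t" using t(1) norm_U by (simp add: T_def norm_mult)
  then show "T k > 0" "pt (I (Suc k)) (R (Suc k)) = pt (I k) (R k) + of_real (T k) * U k"
  "0 < t' \<Longrightarrow> t' < T k \<Longrightarrow> \<not> on_boundary v d (pt (I k) (R k) + of_real t' * U k)"
    using t e by (auto simp: valid_z out_dir_z)
qed

lemma th_Suc: "th (Suc k) = Arg (- tang (I (Suc k)) * cnj (tang (I k)) * cis (- th k))"
  using orbit by (auto simp: is_orbit_def pinball_eq_Some_iff I_def th_def)

lemma cis_th_Suc: "cis (th (Suc k)) = - tang (I (Suc k)) * cnj (tang (I k)) * cis (- th k)"
proof -
  let ?w = "- tang (I (Suc k)) * cnj (tang (I k)) * cis (- th k)"
  have "cmod ?w = 1" using norm_tang valid_z by (simp add: norm_mult)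
  then have "cis (Arg ?w) = ?w" by (subst cis_Arg) (auto simp: sgn_div_norm)
  then show ?thesis using th_Suc by simp
qed

lemma U_Suc: "U (Suc k) = (tang (I (Suc k)))\<^sup>2 * cnj (U k)"
  unfolding U_def cis_th_Suc by (simp add: cis_cnj power2_eq_square)

text \<open>Division by \<open>U k\<close> turns the flight direction into the positive real axis,
  so that imaginary parts measure transversal displacement and real parts displacement along the
  flight.\<close>

lemma tang_div_U: "tang (I k) / U k = - \<i> * cis (- th k)"
proof -
  have "- \<i> * cis (- th k) * U k = - (\<i> * \<i>) * tang (I k) * (cis (- th k) * cis (th k))"
    by (simp add: U_def algebra_simps)
  also have "\<dots> = tang (I k)" by (simp add: cis_mult)
  finally have "tang (I k) = - \<i> * cis (- th k) * U k" ..
  then show ?thesis using U_nz by (simp add: field_simps)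
qed

lemma tang_Suc_div_U: "tang (I (Suc k)) / U k = \<i> * cis (th (Suc k))"
proof -
  have "\<i> * cis (th (Suc k)) * U k = tang (I (Suc k)) * (tang (I k) * cnj (tang (I k))) * (cis (- th k) * cis (th k))"
    unfolding cis_th_Suc U_def by (simp add: algebra_simps)
  also have "\<dots> = tang (I (Suc k))" using tang_cnj valid_z by (simp add: cis_mult)
  finally show ?thesis using U_nz by (simp add: field_simps)
qed

lemma periodic: "I (k + p) = I k" "R (k + p) = R k" "th (k + p) = th k"
  using zp by (auto simp: I_def R_def th_def)

text \<open>
  Displacing the orbit by the signed transversal distance \<open>h\<close> moves its \<open>k\<close>-th collision point by
  \<open>h * c k\<close> along its side; the sign alternates because reflections reverse orientation.
\<close>
definition c :: "nat \<Rightarrow> real" where "c k = (-1) ^ k / cos (th k)"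
text \<open>The rate of change of the length of the \<open>k\<close>-th segment under displacement,
  read off from real parts in \<open>Ph_Suc\<close>.\<close>

definition b :: "nat \<Rightarrow> real" where "b k = c k * sin (th k) - c (Suc k) * sin (th (Suc k))"
definition Rh :: "nat \<Rightarrow> real \<Rightarrow> real" where "Rh k h = R k + h * c k"
definition Ph :: "nat \<Rightarrow> real \<Rightarrow> complex" where "Ph k h = pt (I k) (Rh k h)"

lemma c_cos: "c k * cos (th k) = (-1) ^ k"
  using cos_th[of k] by (simp add: c_def)

lemma c_nz: "c k \<noteq> 0"
  using cos_th[of k] by (simp add: c_def)

lemma Ph_affine: "Ph k h = Ph k 0 + of_real h * (of_real (c k) * tang (I k))"
  by (simp add: Ph_def Rh_def pt_def algebra_simps)

lemma Im_A: "Im (of_real (c k) * tang (I k) / U k) = - ((-1) ^ k)"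
proof -
  have "of_real (c k) * tang (I k) / U k = of_real (c k) * (tang (I k) / U k)" by simp
  also have "Im \<dots> = - (c k * cos (th k))" unfolding tang_div_U by simp
  finally show ?thesis by (simp add: c_cos)
qed

text \<open>The displaced points are again joined in direction \<open>U k\<close>: the alternating
  sign in \<open>c\<close> makes the transversal components at both ends of the segment
  agree.\<close>

lemma Ph_Suc: "Ph (Suc k) h = Ph k h + of_real (T k + h * b k) * U k"
proof -
  have "of_real (c (Suc k)) * (tang (I (Suc k)) / U k) = of_real (c k) * (tang (I k) / U k) + of_real (b k)"
    unfolding tang_div_U tang_Suc_div_U
    using c_cos[of k] c_cos[of "Suc k"] by (intro complex_eqI) (auto simp: b_def)
  then have "of_real (c (Suc k)) * tang (I (Suc k)) = of_real (c k) * tang (I k) + of_real (b k) * U k"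
    using U_nz[of k] by (simp add: field_simps)
  moreover have "Ph (Suc k) 0 = Ph k 0 + of_real (T k) * U k"
    using step(2)[of k] by (simp add: Ph_def Rh_def)
  ultimately show ?thesis
    unfolding Ph_affine[of "Suc k" h] Ph_affine[of k h] by (simp add: algebra_simps)
qed

text \<open>Here the parity of \<open>p\<close> enters, through \<open>(-1) ^ p = 1\<close>.\<close>

lemma c_periodic: "c (k + p) = c k"
  using p by (simp add: c_def periodic power_add)

lemma Ph_periodic: "Ph (k + p) h = Ph k h" "Ph (Suc k + p) h = Ph (Suc k) h"
  using c_periodic periodic by (simp_all add: Ph_def Rh_def del: add_Suc)

text \<open>Makes sense for every real \<open>h\<close>, even where the displaced closed polygonal
  path is no longer a billiard trajectory.\<close>

definition vertex_hits :: "real set" where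
  "vertex_hits = {h. \<exists>k. \<exists>j<d. v j \<in> closed_segment (Ph k h) (Ph (Suc k) h)}"

lemma vertex_hitsI:
  assumes "j < d" "Ph k h = v j"
  shows "h \<in> vertex_hits"
proof -
  have "v j \<in> closed_segment (Ph k h) (Ph (Suc k) h)" unfolding assms(2)[symmetric] by simp
  then show ?thesis using assms(1) unfolding vertex_hits_def by blast
qed

lemma segment_on_line:
  assumes "w \<in> closed_segment (Ph k h) (Ph (Suc k) h)"
  obtains s where "w = Ph k h + of_real s * U k"
proof -
  obtain m where "w = (1 - m) *\<^sub>R Ph k h + m *\<^sub>R Ph (Suc k) h"
    using assms by (auto simp: closed_segment_def)
  then have "w = Ph k h + of_real (m * (T k + h * b k)) * U k"
    unfolding Ph_Suc by (simp add: scaleR_conv_of_real algebra_simps)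
  then show ?thesis by (rule that)
qed

lemma on_segment:
  assumes "0 \<le> s" "s \<le> T k + h * b k"
  shows "Ph k h + of_real s * U k \<in> closed_segment (Ph k h) (Ph (Suc k) h)"
proof (cases "T k + h * b k = 0")
  case True
  then show ?thesis using assms by simp
next
  case False
  define m where "m = s / (T k + h * b k)"
  have "s = m * (T k + h * b k)" "0 \<le> m" "m \<le> 1" using False assms by (auto simp: m_def)
  moreover have "Ph k h + of_real (m * (T k + h * b k)) * U k = (1 - m) *\<^sub>R Ph k h + m *\<^sub>R Ph (Suc k) h"
    unfolding Ph_Suc by (simp add: scaleR_conv_of_real algebra_simps)
  ultimately show ?thesis unfolding closed_segment_def by auto
qed

text \<open>A vertex and the segment index modulo \<open>p\<close> determine \<open>h\<close>,
  because \<open>h\<close> is up to sign the transversal distance of the vertex from the undisplaced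
  segment.\<close>

lemma finite_vertex_hits: "finite vertex_hits"
proof -
  have "vertex_hits \<subseteq> (\<lambda>(k, j). - ((-1) ^ k) * Im ((v j - Ph k 0) / U k)) ` ({..<p} \<times> {..<d})"
  proof
    fix h assume "h \<in> vertex_hits"
    then obtain k j where kj: "j < d" "v j \<in> closed_segment (Ph k h) (Ph (Suc k) h)" by (auto simp: vertex_hits_def)
    define l where "l = k mod p"
    have k: "k = l + (k div p) * p" by (simp add: l_def)
    have "Ph k h = Ph l h" "Ph (Suc k) h = Ph (Suc l) h"
      using periodic_mult[where z = "\<lambda>k. Ph k h" and p = p, OF Ph_periodic(1), of _ "k div p"] k
      by (metis, metis add_Suc)
    then obtain s where s: "v j = Ph l h + of_real s * U l" using kj segment_on_line by metis
    have "(v j - Ph l 0) / U l = of_real h * (of_real (c l) * tang (I l) / U l) + of_real s"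
      unfolding s Ph_affine[of l h] using U_nz by (simp add: field_simps)
    then have "Im ((v j - Ph l 0) / U l) = Im (of_real h * (of_real (c l) * tang (I l) / U l) + of_real s)"
      by (rule arg_cong)
    also have "\<dots> = h * Im (of_real (c l) * tang (I l) / U l)"
      by (simp del: times_divide_eq_right times_divide_eq_left)
    finally have "h = - ((-1) ^ l) * Im ((v j - Ph l 0) / U l)" unfolding Im_A
      by (simp add: power_mult_distrib[symmetric])
    moreover have "l < p" using p by (simp add: l_def)
    ultimately show "h \<in> (\<lambda>(k, j). - ((-1) ^ k) * Im ((v j - Ph k 0) / U k)) ` ({..<p} \<times> {..<d})"
      using kj by force
  qed
  then show ?thesis by (rule finite_subset) auto
qed

text \<open>A collision point depends affinely on the displacement, so before leaving its side it
  would pass through an endpoint, which is a vertex hit.\<close>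

lemma Rh_family:
  assumes h: "h \<le> 0" and nb: "\<And>h'. h \<le> h' \<Longrightarrow> h' \<le> 0 \<Longrightarrow> h' \<notin> vertex_hits"
  shows "0 < Rh k h" "Rh k h < len (I k)"
proof -
  show "0 < Rh k h"
  proof (rule ccontr)
    assume "\<not> 0 < Rh k h"
    then obtain r where r: "0 \<le> r" "r \<le> - h" "R k + r * (- c k) = 0"
      using affine_zero_between[of "R k" "-h" "- c k"] valid_z[of k] h by (auto simp: Rh_def)
    then have "Rh k (- r) = 0" by (simp add: Rh_def)
    then have "Ph k (- r) = v (I k)" by (simp add: Ph_def pt_0)
    then have "- r \<in> vertex_hits" using vertex_hitsI valid_z(1) by blast
    then show False using nb[of "- r"] r by auto
  qed
  show "Rh k h < len (I k)"
  proof (rule ccontr)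
    assume "\<not> Rh k h < len (I k)"
    then obtain r where r: "0 \<le> r" "r \<le> - h" "len (I k) - R k + r * (c k) = 0"
      using affine_zero_between[of "len (I k) - R k" "-h" "c k"] valid_z[of k] h by (auto simp: Rh_def)
    then have "Rh k (- r) = len (I k)" by (simp add: Rh_def)
    then have "Ph k (- r) = v (nxt d (I k))" using valid_z by (simp add: Ph_def pt_len)
    then have "- r \<in> vertex_hits" using vertex_hitsI nxt_less by blast
    then show False using nb[of "- r"] r by auto
  qed
qed

text \<open>The flight is transversal to the side it leaves, as \<open>cos (th k) > 0\<close>, and
  cannot meet the same line again.\<close>

lemma I_Suc_neq: "I (Suc k) \<noteq> I k"
proof
  assume e: "I (Suc k) = I k"
  then have "of_real (R (Suc k) - R k) * tang (I k) = of_real (T k) * U k"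
    using step(2)[of k] by (simp add: pt_def algebra_simps)
  then have "of_real (R (Suc k) - R k) * (tang (I k) / U k) = of_real (T k)"
    using U_nz by (simp add: field_simps)
  then have "Im (of_real (R (Suc k) - R k) * (tang (I k) / U k)) = 0" by simp
  then have "R (Suc k) - R k = 0" unfolding tang_div_U using cos_th[of k] by simp
  then have "T k = 0" using step(2)[of k] e U_nz by simp
  then show False using step(1)[of k] by simp
qed

text \<open>At a zero of the length two consecutive collision points would coincide, although they
  lie in the relative interiors of different sides.\<close>

lemma T_family:
  assumes h: "h \<le> 0" and nb: "\<And>h'. h \<le> h' \<Longrightarrow> h' \<le> 0 \<Longrightarrow> h' \<notin> vertex_hits"
  shows "0 < T k + h * b k"
proof (rule ccontr)
  assume "\<not> 0 < T k + h * b k"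
  then obtain r where r: "0 \<le> r" "r \<le> - h" "T k + r * (- b k) = 0"
    using affine_zero_between[of "T k" "-h" "- b k"] step(1)[of k] h by auto
  then have "T k + (- r) * b k = 0" by simp
  then have e: "Ph (Suc k) (- r) = Ph k (- r)" unfolding Ph_Suc by simp
  have nb': "\<And>h'. - r \<le> h' \<Longrightarrow> h' \<le> 0 \<Longrightarrow> h' \<notin> vertex_hits" using nb r by auto
  note F = Rh_family[of "- r", OF _ nb']
  have "Ph k (- r) \<in> side v d (I k)" using F[of k] r valid_z by (auto simp: Ph_def side_eq)
  then have "I (Suc k) = I k"
    using sides_meet[of "I (Suc k)" "I k" "Rh (Suc k) (- r)"] F[of "Suc k"] r valid_z e by (auto simp: Ph_def)
  then show False using I_Suc_neq by simp
qed

text \<open>\<open>strip_free\<close> is applied to each side \<open>j\<close> as the obstacle; the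
  lateral edges of the strip are the paths of the two collision points along their own
  sides.\<close>

lemma free_family:
  assumes h: "h \<le> 0" and nb: "\<And>h'. h \<le> h' \<Longrightarrow> h' \<le> 0 \<Longrightarrow> h' \<notin> vertex_hits"
    and s: "0 < s" "s < T k + h * b k"
  shows "\<not> on_boundary v d (Ph k h + of_real s * U k)"
proof
  assume "on_boundary v d (Ph k h + of_real s * U k)"
  then obtain j where j: "j < d" "Ph k h + of_real s * U k \<in> side v d j" by (auto simp: on_boundary_def)
  let ?A = "of_real (c k) * tang (I k)"
  have P: "Ph k 0 + of_real h' * ?A = Ph k h'" for h' using Ph_affine[of k h'] by simp
  have F: "0 < Rh k' h'" "Rh k' h' < len (I k')" if "h \<le> h'" "h' \<le> 0" for k' h'
    using Rh_family[of h' k'] nb that by auto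
  \<comment> \<open>A side containing a collision point, which is interior to side
    \<open>I k'\<close>, is that side itself and so lies on the line traced by the collision
    point.\<close>
  have line: "\<exists>h''. q = Ph k' h''" if "Ph k' h' \<in> side v d j" "h \<le> h'" "h' \<le> 0" "q \<in> side v d j" for k' h' q
  proof -
    have qj: "q \<in> side v d j" by (rule that)
    have "I k' = j" using that F valid_z j sides_meet unfolding Ph_def by blast
    then obtain r where r: "q = pt (I k') r" using qj j(1) side_eq by blast
    have "Rh k' ((r - R k') / c k') = r" using c_nz by (simp add: Rh_def)
    then show ?thesis using r by (metis Ph_def)
  qed
  have "Ph k 0 + of_real h * ?A + of_real s * U k \<notin> closed_segment (v j) (v (nxt d j))"
  proof (rule strip_free[where tc = "T k" and b = "b k" and h = h])
    show "Im (?A / U k) \<noteq> 0" unfolding Im_A by simp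
    show "h \<le> 0" by (rule h)
    fix h' assume h': "h \<le> h'" "h' \<le> 0"
    show "Ph k 0 + of_real h' * ?A + of_real s' * U k \<noteq> w"
      if "0 \<le> s'" "s' \<le> T k + h' * b k" "w \<in> {v j, v (nxt d j)}" for s' w
    proof
      assume "Ph k 0 + of_real h' * ?A + of_real s' * U k = w"
      then have "w \<in> closed_segment (Ph k h') (Ph (Suc k) h')" using on_segment[of s' k h'] that by (simp add: P)
      then have "h' \<in> vertex_hits" using that j nxt_less unfolding vertex_hits_def by blast
      then show False using nb h' by blast
    qed
    show "\<forall>q\<in>closed_segment (v j) (v (nxt d j)). \<exists>h''. q = Ph k 0 + of_real h'' * ?A"
      if "Ph k 0 + of_real h' * ?A \<in> closed_segment (v j) (v (nxt d j))"
      using line[of k h'] that h' unfolding P side_def by blast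
    show "\<forall>q\<in>closed_segment (v j) (v (nxt d j)). \<exists>h''. q = Ph k 0 + of_real h'' * ?A + of_real (T k + h'' * b k) * U k"
      if "Ph k 0 + of_real h' * ?A + of_real (T k + h' * b k) * U k \<in> closed_segment (v j) (v (nxt d j))"
      using line[of "Suc k" h'] that h' unfolding P side_def Ph_Suc by blast
  next
    fix s' assume "0 < s'" "s' < T k + 0 * b k"
    then show "Ph k 0 + of_real 0 * ?A + of_real s' * U k \<notin> closed_segment (v j) (v (nxt d j))"
      using step(3)[of s' k] j unfolding on_boundary_def side_def by (auto simp: Ph_def Rh_def)
  qed (use s in auto)
  then show False using j unfolding P side_def by simp
qed

definition zh :: "real \<Rightarrow> nat \<Rightarrow> real \<times> real" where
  "zh h k = (cm (I k) + Rh k h, th k)"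

lemma zh_orbit:
  assumes h: "h \<le> 0" and nb: "\<And>h'. h \<le> h' \<Longrightarrow> h' \<le> 0 \<Longrightarrow> h' \<notin> vertex_hits"
  shows "is_orbit 1 (zh h)" "sd (fst (zh h k)) = I k" "zh h (k + p) = zh h k"
proof -
  have V: "valid_pos v d (fst (zh h k))" "sd (fst (zh h k)) = I k" "bpt v d (fst (zh h k)) = Ph k h"
    "valid_state v d (zh h k)" for k
    using valid_posI[OF valid_z(1) Rh_family[OF h nb, of k]] valid_z[of k]
    by (auto simp: zh_def Ph_def valid_state_def)
  have U: "out_dir v d (zh h k) = U k" for k
    unfolding out_dir_def V(2) by (simp add: zh_def U_def inward_normal_def)
  show "sd (fst (zh h k)) = I k" by (rule V)
  show "zh h (k + p) = zh h k" using periodic c_periodic by (simp add: zh_def Rh_def)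
  show "is_orbit 1 (zh h)"
    unfolding is_orbit_def pinball_eq_Some_iff
  proof (intro allI conjI)
    fix k
    show "hits v d (zh h k) (fst (zh h (Suc k)))"
      unfolding hits_def V(3) U
      using V T_family[OF h nb, of k] free_family[OF h nb] Ph_Suc by blast
    show "valid_state v d (zh h (Suc k))" by (rule V)
    show "snd (zh h (Suc k)) = 1 * Arg (- tang (sd (fst (zh h (Suc k)))) * cnj (tang (sd (fst (zh h k)))) * cis (- snd (zh h k)))"
      unfolding V(2) using th_Suc[of k] by (simp add: zh_def)
  qed
qed

lemma zero_not_vertex_hit: "0 \<notin> vertex_hits"
proof
  assume "0 \<in> vertex_hits"
  then obtain k j where kj: "j < d" "v j \<in> closed_segment (Ph k 0) (Ph (Suc k) 0)" by (auto simp: vertex_hits_def)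
  obtain m where m: "0 \<le> m" "m \<le> 1" "v j = (1 - m) *\<^sub>R Ph k 0 + m *\<^sub>R Ph (Suc k) 0"
    using kj by (auto simp: closed_segment_def)
  have e: "v j = Ph k 0 + of_real (m * T k) * U k"
    unfolding m Ph_Suc by (simp add: scaleR_conv_of_real algebra_simps)
  have "v j \<in> side v d j" by (simp add: side_def)
  then have "on_boundary v d (v j)" using kj by (auto simp: on_boundary_def)
  then have "\<not> (0 < m * T k \<and> m * T k < T k)"
    using step(3)[of "m * T k" k] e by (auto simp: Ph_def Rh_def)
  then have "m = 0 \<or> m = 1" using m step(1)[of k] by (auto simp: zero_less_mult_iff)
  then have "v j = Ph k 0 \<or> v j = Ph (Suc k) 0" using m by auto
  then show False
    using pt_not_vertex[of "I k" "R k" j] pt_not_vertex[of "I (Suc k)" "R (Suc k)" j] valid_z kj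
    by (auto simp: Ph_def Rh_def)
qed

text \<open>The first displacement in the negative direction at which a vertex is met.\<close>
definition edge :: real where "edge = Max (vertex_hits \<inter> {..<0})"

lemma edge: "edge \<in> vertex_hits" "edge < 0" "edge < h \<Longrightarrow> h \<le> 0 \<Longrightarrow> h \<notin> vertex_hits"
proof -
  \<comment> \<open>Some negative displacement meets a vertex: \<open>- R 0 / c 0\<close> slides the
    initial collision point back to the start of its side.\<close>
  have "c 0 > 0" using cos_th[of 0] by (simp add: c_def)
  then have "- R 0 / c 0 < 0" using valid_z[of 0] by (simp add: divide_neg_pos)
  moreover have "Rh 0 (- R 0 / c 0) = 0" using c_nz by (simp add: Rh_def)
  then have "Ph 0 (- R 0 / c 0) = v (I 0)" by (simp add: Ph_def pt_0)
  then have "- R 0 / c 0 \<in> vertex_hits" using vertex_hitsI valid_z(1) by blast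
  ultimately have ne: "vertex_hits \<inter> {..<0} \<noteq> {}" by blast
  have "edge \<in> vertex_hits \<inter> {..<0}" unfolding edge_def using finite_vertex_hits ne by (intro Max_in) auto
  then show "edge \<in> vertex_hits" "edge < 0" by auto
  show "h \<notin> vertex_hits" if "edge < h" "h \<le> 0"
  proof
    assume hb: "h \<in> vertex_hits"
    then have "h \<noteq> 0" using zero_not_vertex_hit by blast
    then have "h \<le> edge" unfolding edge_def using that hb finite_vertex_hits by (intro Max_ge) auto
    then show False using that by simp
  qed
qed

end

section \<open>Angles of stable orbits\<close>

definition root_of_unity :: "complex \<Rightarrow> bool" where
  "root_of_unity z \<longleftrightarrow> (\<exists>N>0. z ^ N = 1)"

lemma root_of_unity_mult: "root_of_unity x \<Longrightarrow> root_of_unity y \<Longrightarrow> root_of_unity (x * y)"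
proof -
  assume "root_of_unity x" "root_of_unity y"
  then obtain M N where "M > 0" "N > 0" "x ^ M = 1" "y ^ N = 1" by (auto simp: root_of_unity_def)
  then have "M * N > 0" "(x * y) ^ (M * N) = 1"
    by (simp_all add: power_mult_distrib power_mult, metis power_mult power_one mult.commute)
  then show ?thesis unfolding root_of_unity_def by blast
qed

lemma root_of_unity_cnj: "root_of_unity x \<Longrightarrow> root_of_unity (cnj x)"
  unfolding root_of_unity_def by (metis complex_cnj_one complex_cnj_power)

lemma root_of_unity_minus: "root_of_unity x \<Longrightarrow> root_of_unity (- x)"
proof -
  assume "root_of_unity x"
  moreover have "root_of_unity (- 1)" unfolding root_of_unity_def by (intro exI[of _ 2]) auto
  ultimately have "root_of_unity (- 1 * x)" using root_of_unity_mult by blast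
  then show ?thesis by simp
qed

lemma root_of_unity_cis_iff: "root_of_unity (cis a) \<longleftrightarrow> a / pi \<in> \<rat>"
proof
  assume "root_of_unity (cis a)"
  then obtain N where N: "N > 0" "cis a ^ N = 1" by (auto simp: root_of_unity_def)
  then have "cis (of_nat N * a) = 1" by (simp add: Complex.DeMoivre[symmetric])
  then have "cos (of_nat N * a) = 1" by (metis cis.sel(1) one_complex.sel(1))
  then obtain n :: int where "of_nat N * a = of_int n * 2 * pi" using cos_one_2pi_int by blast
  then have "a / pi = of_int (2 * n) / of_nat N" using N by (simp add: field_simps)
  also have "\<dots> \<in> \<rat>" by (intro Rats_divide) auto
  finally show "a / pi \<in> \<rat>" .
next
  assume "a / pi \<in> \<rat>"
  then obtain m :: int and n :: nat where mn: "n > 0" "a / pi = of_int m / of_nat n"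
    by (metis Rats_cases' of_int_of_nat_eq pos_int_cases zero_less_imp_eq_int)
  then have "of_nat (2 * n) * a = 2 * pi * of_int m" by (simp add: field_simps)
  then have "cis a ^ (2 * n) = cis (2 * pi * of_int m)" by (simp only: Complex.DeMoivre)
  also have "\<dots> = 1" by (rule cis_multiple_2pi) auto
  finally show "root_of_unity (cis a)" using mn unfolding root_of_unity_def by (intro exI[of _ "2 * n"]) auto
qed

context simple_poly
begin

text \<open>The ratio of consecutive tangents has the exterior angle as argument; telescoping
  products compare every side with side 0.\<close>

lemma tang_ratio_root_of_unity:
  assumes rat: "rational_polygon v d" and "i < d" "j < d"
  shows "root_of_unity (tang i * cnj (tang j))"
proof -
  have step: "root_of_unity (tang (Suc i) * cnj (tang i))" if i: "Suc i < d" for i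
  proof -
    have pr: "prv d (Suc i) = i" using i by (simp add: prv_def)
    have nx: "nxt d i = Suc i" using i by (simp add: nxt_def)
    let ?q = "(v (nxt d (Suc i)) - v (Suc i)) / (v (Suc i) - v i)"
    have "interior_angle v d (Suc i) / pi \<in> \<rat>" using rat i by (auto simp: rational_polygon_def)
    then have "1 - interior_angle v d (Suc i) / pi \<in> \<rat>" by (intro Rats_diff) auto
    also have "1 - interior_angle v d (Suc i) / pi = Arg ?q / pi"
      by (simp add: interior_angle_def pr field_simps)
    finally have r: "root_of_unity (cis (Arg ?q))" by (simp add: root_of_unity_cis_iff)
    have l: "len (Suc i) > 0" "len i > 0" using len_pos i by auto
    have e1: "v (nxt d (Suc i)) - v (Suc i) = of_real (len (Suc i)) * tang (Suc i)"
      using pt_len[OF i] by (simp add: pt_def algebra_simps)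
    have e2: "v (Suc i) - v i = of_real (len i) * tang i"
      using pt_len[of i] i nx by (simp add: pt_def algebra_simps)
    have tc: "1 / tang i = cnj (tang i)" using tang_cnj[of i] tang_nz[of i] i by (simp add: field_simps)
    have "?q = of_real (len (Suc i) / len i) * (tang (Suc i) * (1 / tang i))"
      unfolding e1 e2 by simp
    then have "?q = of_real (len (Suc i) / len i) * (tang (Suc i) * cnj (tang i))" unfolding tc .
    moreover have "cmod (tang (Suc i) * cnj (tang i)) = 1" using norm_tang i by (simp add: norm_mult)
    ultimately have "sgn ?q = tang (Suc i) * cnj (tang i)"
      using l norm_tang i by (simp only: sgn_mult sgn_of_real) (simp add: sgn_div_norm)
    moreover have "?q \<noteq> 0" unfolding e1 e2 using l tang_nz i by auto
    ultimately have "cis (Arg ?q) = tang (Suc i) * cnj (tang i)" by (simp add: cis_Arg)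
    then show ?thesis using r by simp
  qed
  have z: "root_of_unity (tang i * cnj (tang 0))" if "i < d" for i
    using that
  proof (induction i)
    case 0
    then show ?case using tang_cnj by (auto simp: root_of_unity_def intro!: exI[of _ 1])
  next
    case (Suc i)
    then have "root_of_unity ((tang (Suc i) * cnj (tang i)) * (tang i * cnj (tang 0)))"
      using root_of_unity_mult step by auto
    also have "(tang (Suc i) * cnj (tang i)) * (tang i * cnj (tang 0)) = tang (Suc i) * cnj (tang 0) * (tang i * cnj (tang i))"
      by (simp add: algebra_simps)
    finally show ?case using tang_cnj Suc by simp
  qed
  have d0: "0 < d" using assms by auto
  have "root_of_unity ((tang i * cnj (tang 0)) * cnj (tang j * cnj (tang 0)))"
    using z assms root_of_unity_mult root_of_unity_cnj by blast
  also have "(tang i * cnj (tang 0)) * cnj (tang j * cnj (tang 0)) = tang i * cnj (tang j) * (tang 0 * cnj (tang 0))"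
    by (simp add: algebra_simps)
  finally show ?thesis using tang_cnj[OF d0] by simp
qed

end

section \<open>The angle recursion and its limit as lambda tends to 1\<close>

context billiard_orbit
begin

text \<open>The \<open>\<delta>\<close> of the overview. Taking it from the actual angles of the
  billiard orbit fixes the representative modulo \<open>2 * pi\<close>.\<close>

definition angle_sum :: "nat \<Rightarrow> real" where "angle_sum k = th k + th (Suc k)"

lemma cis_angle_sum: "cis (angle_sum k) = - tang (I (Suc k)) * cnj (tang (I k))"
proof -
  have "cis (angle_sum k) = cis (th (Suc k)) * cis (th k)" by (simp add: angle_sum_def cis_mult add.commute)
  also have "\<dots> = - tang (I (Suc k)) * cnj (tang (I k)) * (cis (- th k) * cis (th k))"
    unfolding cis_th_Suc by (simp add: algebra_simps)
  finally show ?thesis by (simp add: cis_mult)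
qed

lemma angle_sum_rational:
  assumes "rational_polygon v d"
  shows "angle_sum k / pi \<in> \<rat>"
proof -
  have "root_of_unity (- (tang (I (Suc k)) * cnj (tang (I k))))"
    using tang_ratio_root_of_unity[OF assms] valid_z root_of_unity_minus by blast
  then show ?thesis using cis_angle_sum by (simp add: root_of_unity_cis_iff[symmetric])
qed

lemma angle_sum_periodic: "angle_sum (k + p) = angle_sum k"
  using periodic(3)[of k] periodic(3)[of "Suc k"] by (simp add: angle_sum_def)

text \<open>Periodicity leaves finitely many values, each strictly between \<open>- pi\<close> and
  \<open>pi\<close>, so the gap is uniform.\<close>

lemma angle_sum_bound: "\<exists>e>0. \<forall>k. \<bar>angle_sum k\<bar> \<le> pi - e"
proof -
  define M where "M = Max ((\<lambda>k. \<bar>angle_sum k\<bar>) ` {..<p})"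
  have ne: "(\<lambda>k. \<bar>angle_sum k\<bar>) ` {..<p} \<noteq> {}" using p by auto
  have "\<bar>angle_sum k\<bar> < pi" for k using valid_z(4,5)[of k] valid_z(4,5)[of "Suc k"] by (auto simp: angle_sum_def)
  then have "M < pi" unfolding M_def using ne by (subst Max_less_iff) auto
  moreover have "\<bar>angle_sum k\<bar> \<le> M" for k
  proof -
    have "angle_sum k = angle_sum (k mod p + (k div p) * p)" by simp
    also have "\<dots> = angle_sum (k mod p)" by (rule periodic_mult[where z = angle_sum]) (rule angle_sum_periodic)
    finally show ?thesis unfolding M_def using p by (intro Max_ge) auto
  qed
  ultimately show ?thesis by (intro exI[of _ "pi - M"]) auto
qed

text \<open>The solution of the angle recursion that starts at 0; every other solution differs from
  it by \<open>(- l) ^ n\<close> times its initial value.\<close>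

primrec S :: "real \<Rightarrow> nat \<Rightarrow> real" where
  "S l 0 = 0"
| "S l (Suc n) = l * (angle_sum n - S l n)"

text \<open>The derivative of \<open>S\<close> in \<open>l\<close> at \<open>l = 1\<close>, written
  as a recursion so that its rationality over pi follows by induction.\<close>

primrec S' :: "nat \<Rightarrow> real" where
  "S' 0 = 0"
| "S' (Suc n) = (angle_sum n - S 1 n) - S' n"

lemma S_deriv: "((\<lambda>l. S l n) has_real_derivative S' n) (at 1)"
proof (induction n)
  case (Suc n)
  show ?case unfolding S.simps by (auto intro!: derivative_eq_intros Suc)
qed simp

lemma S_rat:
  assumes "rational_polygon v d"
  shows "S 1 n / pi \<in> \<rat> \<and> S' n / pi \<in> \<rat>"
proof (induction n)
  case (Suc n)
  have "angle_sum n / pi - S 1 n / pi \<in> \<rat>" using Suc angle_sum_rational[OF assms] by (intro Rats_diff) auto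
  moreover from this have "angle_sum n / pi - S 1 n / pi - S' n / pi \<in> \<rat>" using Suc Rats_diff by blast
  ultimately show ?case by (simp add: diff_divide_distrib)
qed simp

lemma S_closed_form:
  assumes "\<And>k. f (Suc k) = l * (angle_sum k - f k)"
  shows "f n = (- l) ^ n * f 0 + S l n"
  by (induction n) (auto simp: assms algebra_simps)

text \<open>
  The recursion is clear modulo \<open>2\<pi>\<close>. Since the angle sums of the unperturbed orbit stay away from
  \<open>\<plusminus>\<pi>\<close>, for \<open>l\<close> close to 1 there is no room for a nonzero multiple of \<open>2\<pi>\<close>.
\<close>
lemma pinball_angle_step:
  assumes y: "is_orbit l y" and sides: "\<And>k. sd (fst (y k)) = I k"
    and e: "\<And>k. \<bar>angle_sum k\<bar> \<le> pi - e" and l: "l > 0" "pi / 2 + pi / (2 * l) \<le> pi + e"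
  shows "snd (y (Suc k)) = l * (angle_sum k - snd (y k))"
proof -
  let ?w = "- tang (I (Suc k)) * cnj (tang (I k)) * cis (- snd (y k))"
  have a: "snd (y (Suc k)) = l * Arg ?w"
    using y sides by (auto simp: is_orbit_def pinball_eq_Some_iff)
  have w: "?w = cis (angle_sum k - snd (y k))"
    unfolding cis_angle_sum[symmetric] by (simp add: cis_mult)
  have "cis (Arg ?w) = ?w" unfolding w by (subst cis_Arg) (auto simp: sgn_div_norm)
  then have "cis (Arg ?w - (angle_sum k - snd (y k))) = 1" unfolding w by (simp add: cis_divide[symmetric])
  then have "cos (Arg ?w - (angle_sum k - snd (y k))) = 1" by (metis cis.sel(1) one_complex.sel(1))
  then obtain n :: int where n: "Arg ?w - (angle_sum k - snd (y k)) = of_int n * 2 * pi"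
    using cos_one_2pi_int by blast
  have "\<bar>snd (y (Suc k))\<bar> < pi / 2" "\<bar>snd (y k)\<bar> < pi / 2"
    using is_orbit_valid[OF y, of k] is_orbit_valid[OF y, of "Suc k"] by (auto simp: valid_state_def)
  moreover from this(1) have "\<bar>Arg ?w\<bar> < pi / (2 * l)"
    unfolding a using l by (simp add: abs_mult field_simps)
  \<comment> \<open>The left side is the absolute value of \<open>Arg ?w + snd (y k)\<close>, hence
    below \<open>pi / (2 * l) + pi / 2\<close>.\<close>
  ultimately have "\<bar>angle_sum k + of_int n * 2 * pi\<bar> < pi + e" using n l by linarith
  then have lt: "\<bar>of_int n * 2 * pi\<bar> < 2 * pi" using e[of k] by linarith
  have "n = 0"
  proof (rule ccontr)
    assume "n \<noteq> 0"
    then have "1 \<le> \<bar>of_int n :: real\<bar>" by linarith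
    then have "1 * (2 * pi) \<le> \<bar>of_int n\<bar> * (2 * pi)" by (intro mult_right_mono) auto
    then show False using lt by (simp add: abs_mult)
  qed
  then show ?thesis using n a by simp
qed

text \<open>The period \<open>m\<close> of the perturbed orbit is unrelated to \<open>p\<close>. The
  difference of \<open>f\<close> and its shift by \<open>p\<close> solves the homogeneous recursion
  with factor \<open>- l\<close>, whose only periodic solution is 0 since \<open>l\<close> is
  positive and not 1. So \<open>f\<close> has period \<open>p\<close> at the start, and evenness of
  \<open>p\<close> turns \<open>(- l) ^ p\<close> into \<open>l ^ p\<close>.\<close>

lemma pinball_angle_fixed:
  assumes step: "\<And>k. f (Suc k) = l * (angle_sum k - f k)" and l: "l > 0" "l \<noteq> 1"
    and m: "m > 0" "\<And>k. f (k + m) = f k"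
  shows "(1 - l ^ p) * f 0 = S l p"
proof -
  define g where "g = (\<lambda>k. f (k + p) - f k)"
  have gS: "g (Suc k) = - l * g k" for k
    by (simp add: g_def step angle_sum_periodic algebra_simps)
  have g: "g k = (- l) ^ k * g 0" for k
    by (induction k) (auto simp: gS)
  have "g m = g 0" using m(2)[of p] m(2)[of 0] by (simp add: g_def add.commute)
  then have "(- l) ^ m * g 0 = g 0" using g[of m] by simp
  moreover have "(- l) ^ m \<noteq> 1"
  proof
    assume "(- l) ^ m = 1"
    then have "\<bar>- l\<bar> ^ m = 1" by (metis abs_one power_abs)
    then have "l ^ m = 1 ^ m" using l by simp
    then show False using l m(1) power_eq_imp_eq_base[of l m 1] by simp
  qed
  ultimately have "g 0 = 0" by simp
  then have "f p = f 0" by (simp add: g_def)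
  then show ?thesis using S_closed_form[OF step, where n = p] p by (simp add: algebra_simps)
qed

text \<open>Dividing the fixed-point equation by \<open>l - 1\<close> and passing to the limit
  yields \<open>- p * th 0 = S' p\<close>.\<close>

lemma stable_angle_rational:
  assumes rat: "rational_polygon v d"
    and lim: "lams \<longlonglongrightarrow> 1" "ys \<longlonglongrightarrow> z 0" and ne: "\<And>n. lams n \<noteq> 1"
    and per: "\<And>n. periodic_pt v d (lams n) (ys n)"
    and itin: "\<And>n. itin v d (lams n) (ys n) = itin v d 1 (z 0)"
  shows "th 0 / pi \<in> \<rat>"
proof -
  obtain e where e: "e > 0" "\<And>k. \<bar>angle_sum k\<bar> \<le> pi - e" using angle_sum_bound by blast
  have "(\<lambda>n. pi / 2 + pi / (2 * lams n)) \<longlonglongrightarrow> pi / 2 + pi / (2 * 1)"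
    by (intro tendsto_intros lim) auto
  then have "eventually (\<lambda>n. pi / 2 + pi / (2 * lams n) < pi + e) sequentially"
    by (rule order_tendstoD) (use e in auto)
  moreover have "eventually (\<lambda>n. lams n > 0) sequentially"
    using order_tendstoD(1)[OF lim(1), of 0] by simp
  ultimately have ev: "eventually (\<lambda>n. (1 - lams n ^ p) * snd (ys n) = S (lams n) p) sequentially"
  proof eventually_elim
    case (elim n)
    obtain y m where y: "m > 0" "y 0 = ys n" "is_orbit (lams n) y" "\<And>k. y (k + m) = y k"
      using periodic_ptE[OF per[of n]] by metis
    have "sd (fst (y k)) = I k" for k
      using fun_cong[OF itin[of n], of k] is_orbit_itin[OF y(3), of 0] is_orbit_itin[OF orbit, of 0] y(2)
      by (simp add: I_def)
    then have st: "\<And>k. snd (y (Suc k)) = lams n * (angle_sum k - snd (y k))"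
      using pinball_angle_step[OF y(3) _ e(2)] elim by auto
    show ?case using pinball_angle_fixed[of "\<lambda>k. snd (y k)", OF st elim(2) ne y(1)] y by simp
  qed
  \<comment> \<open>The unperturbed angles solve the recursion for \<open>l = 1\<close> and return
    after the even time \<open>p\<close>, so \<open>th 0 = th 0 + S 1 p\<close>.\<close>
  have S1: "S 1 p = 0"
    using S_closed_form[of th 1 p] p periodic(3)[of 0] by (simp add: angle_sum_def)
  have at1: "filterlim lams (at 1) sequentially"
    using lim(1) ne by (simp add: filterlim_at)
  have "((\<lambda>l. (S l p - S 1 p) / (l - 1)) \<longlongrightarrow> S' p) (at 1)"
    using S_deriv[of p] by (simp add: has_field_derivative_iff)
  then have L1: "(\<lambda>n. S (lams n) p / (lams n - 1)) \<longlonglongrightarrow> S' p"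
    using filterlim_compose[OF _ at1] S1 by fastforce
  have "((\<lambda>l::real. l ^ p) has_real_derivative of_nat p * 1 ^ (p - 1)) (at 1)"
    by (auto intro!: derivative_eq_intros)
  then have "((\<lambda>l::real. (l ^ p - 1) / (l - 1)) \<longlongrightarrow> of_nat p) (at 1)"
    by (simp add: has_field_derivative_iff)
  then have L2: "(\<lambda>n. (lams n ^ p - 1) / (lams n - 1)) \<longlonglongrightarrow> of_nat p"
    by (rule filterlim_compose[OF _ at1])
  have "(\<lambda>n. - (((lams n ^ p - 1) / (lams n - 1)) * snd (ys n))) \<longlonglongrightarrow> - (of_nat p * snd (z 0))"
    by (intro tendsto_intros L2 lim)
  moreover have "eventually (\<lambda>n. - (((lams n ^ p - 1) / (lams n - 1)) * snd (ys n)) = S (lams n) p / (lams n - 1)) sequentially"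
    using ev
  proof eventually_elim
    case (elim n)
    then show ?case unfolding elim[symmetric] using ne[of n] by (simp add: field_simps)
  qed
  ultimately have "(\<lambda>n. S (lams n) p / (lams n - 1)) \<longlonglongrightarrow> - (of_nat p * snd (z 0))"
    by (rule Lim_transform_eventually)
  then have "- (of_nat p * th 0) = S' p" using LIMSEQ_unique L1 by (simp add: th_def)
  then have "th 0 / pi = - (S' p / pi) / of_nat p" using p by (simp add: field_simps)
  also have "\<dots> \<in> \<rat>" using S_rat[OF rat] by (intro Rats_divide) auto
  finally show ?thesis .
qed

lemma root_of_unity_all_angles:
  assumes "rational_polygon v d" "th 0 / pi \<in> \<rat>"
  shows "root_of_unity (cis (th k))"
proof (induction k)
  case 0
  then show ?case using assms by (simp add: root_of_unity_cis_iff)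
next
  case (Suc k)
  have "cis (th (Suc k)) = cis (angle_sum k) * cnj (cis (th k))"
    unfolding cis_th_Suc cis_angle_sum by (simp add: cis_cnj)
  moreover have "root_of_unity (cis (angle_sum k))" using angle_sum_rational assms by (simp add: root_of_unity_cis_iff)
  ultimately show ?case using Suc root_of_unity_mult root_of_unity_cnj by metis
qed

end

section \<open>Directions of periodic orbits\<close>

context billiard_orbit
begin

definition Q :: "nat \<Rightarrow> complex" where "Q k = pt (I k) (R k)"

text \<open>A collision point is fixed by the reflection in the line of its side.\<close>

lemma reflect_Q: "(tang (I k))\<^sup>2 * cnj (Q k - v (I k)) = Q k - v (I k)"
proof -
  have "(tang (I k))\<^sup>2 * cnj (Q k - v (I k)) = of_real (R k) * tang (I k) * (tang (I k) * cnj (tang (I k)))"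
    by (simp add: Q_def pt_def power2_eq_square)
  then show ?thesis using tang_cnj valid_z by (simp add: Q_def pt_def)
qed

lemma cnj_reflect_Q: "cnj ((tang (I k))\<^sup>2) * (Q k - v (I k)) = cnj (Q k - v (I k))"
  using arg_cong[OF reflect_Q[of k], of cnj] by simp

text \<open>\<open>m\<close> and \<open>a\<close> are the coefficients of the unfolding isometry,
  \<open>x\<close> to \<open>m * x + a\<close> or \<open>m * cnj x + a\<close>, which carries the
  \<open>k\<close>-th collision onto the straight ray from \<open>Q 0\<close> in direction
  \<open>U 0\<close>; \<open>L\<close> is the distance travelled. The conjugates are tracked because
  reflections conjugate coefficients.\<close>

lemma unfold_orbit:
  assumes A: "fin_subalg A"
    and vA: "\<And>i. i < d \<Longrightarrow> v i \<in> A \<and> cnj (v i) \<in> A"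
    and tA: "\<And>i. i < d \<Longrightarrow> (tang i)\<^sup>2 \<in> A \<and> cnj ((tang i)\<^sup>2) \<in> A"
  shows "\<exists>m a L. m \<in> A \<and> cnj m \<in> A \<and> a \<in> A \<and> cnj a \<in> A \<and> L \<ge> 0 \<and> (k > 0 \<longrightarrow> L > 0) \<and>
     (if even k then m * U k = U 0 \<and> m * Q k + a = Q 0 + of_real L * U 0
      else m * cnj (U k) = U 0 \<and> m * cnj (Q k) + a = Q 0 + of_real L * U 0)"
proof (induction k)
  case 0
  show ?case
    by (rule exI[of _ 1], rule exI[of _ 0], rule exI[of _ 0]) (use fin_subalgD[OF A] in auto)
next
  case (Suc k)
  then obtain m a L where IH: "m \<in> A" "cnj m \<in> A" "a \<in> A" "cnj a \<in> A" "L \<ge> 0"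
     "if even k then m * U k = U 0 \<and> m * Q k + a = Q 0 + of_real L * U 0
      else m * cnj (U k) = U 0 \<and> m * cnj (Q k) + a = Q 0 + of_real L * U 0"
    by blast
  define w t where "w = v (I (Suc k))" and "t = (tang (I (Suc k)))\<^sup>2"
  have wA: "w \<in> A" "cnj w \<in> A" "t \<in> A" "cnj t \<in> A" using vA tA valid_z by (auto simp: w_def t_def)
  have tt: "t * cnj t = 1"
    using tang_cnj[OF valid_z(1), of "Suc k"]
    by (simp add: t_def power2_eq_square) (metis mult.assoc mult.commute mult_1)
  have Us: "U (Suc k) = t * cnj (U k)" by (simp add: U_Suc t_def)
  have Qs: "Q (Suc k) = Q k + of_real (T k) * U k" using step(2) by (simp add: Q_def)
  have r1: "t * cnj (Q (Suc k)) - t * cnj w = Q (Suc k) - w"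
    using reflect_Q[of "Suc k"] by (simp add: t_def w_def algebra_simps)
  have r2: "cnj t * Q (Suc k) - cnj t * w = cnj (Q (Suc k)) - cnj w"
    using cnj_reflect_Q[of "Suc k"] by (simp add: t_def w_def algebra_simps)
  have L: "L + T k > 0" using IH(5) step(1)[of k] by simp
  note cl = fin_subalgD(1,2,5)[OF A]
  show ?case
  \<comment> \<open>In both cases the new coefficients come from composing the isometry with the
    reflection \<open>x\<close> to \<open>w + t * (cnj x - cnj w)\<close> in the next side.\<close>
  proof (cases "even k")
    case True
    then have IH': "m * U k = U 0" "m * Q k + a = Q 0 + of_real L * U 0" using IH by auto
    have "m * t * cnj (U (Suc k)) = (t * cnj t) * (m * U k)" by (simp add: Us algebra_simps)
    then have 1: "m * t * cnj (U (Suc k)) = U 0" using tt IH' by simp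
    have "m * t * cnj (Q (Suc k)) + (a + m * w - m * t * cnj w) = m * (t * cnj (Q (Suc k)) - t * cnj w) + m * w + a"
      by (simp add: algebra_simps)
    also have "\<dots> = (m * Q k + a) + of_real (T k) * (m * U k)" unfolding r1 by (simp add: Qs algebra_simps)
    also have "\<dots> = Q 0 + of_real (L + T k) * U 0" unfolding IH' by (simp add: algebra_simps)
    finally have 2: "m * t * cnj (Q (Suc k)) + (a + m * w - m * t * cnj w) = Q 0 + of_real (L + T k) * U 0" .
    show ?thesis
      using 1 2 True L IH wA
      by (intro exI[of _ "m * t"] exI[of _ "a + m * w - m * t * cnj w"] exI[of _ "L + T k"])
         (auto intro!: cl)
  next
    case False
    then have IH': "m * cnj (U k) = U 0" "m * cnj (Q k) + a = Q 0 + of_real L * U 0" using IH by auto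
    have "m * cnj t * U (Suc k) = (t * cnj t) * (m * cnj (U k))" by (simp add: Us algebra_simps)
    then have 1: "m * cnj t * U (Suc k) = U 0" using tt IH' by simp
    have "m * cnj t * Q (Suc k) + (a + m * cnj w - m * cnj t * w) = m * (cnj t * Q (Suc k) - cnj t * w) + m * cnj w + a"
      by (simp add: algebra_simps)
    also have "\<dots> = (m * cnj (Q k) + a) + of_real (T k) * (m * cnj (U k))" unfolding r2 by (simp add: Qs algebra_simps)
    also have "\<dots> = Q 0 + of_real (L + T k) * U 0" unfolding IH' by (simp add: algebra_simps)
    finally have 2: "m * cnj t * Q (Suc k) + (a + m * cnj w - m * cnj t * w) = Q 0 + of_real (L + T k) * U 0" .
    show ?thesis
      using 1 2 False L IH wA
      by (intro exI[of _ "m * cnj t"] exI[of _ "a + m * cnj w - m * cnj t * w"] exI[of _ "L + T k"])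
         (auto intro!: cl)
  qed
qed

text \<open>Over the even period \<open>p\<close> the unfolding preserves orientation and fixes the
  direction \<open>U 0\<close>, so it is the translation by \<open>a = L * U 0\<close>. Hence
  \<open>a / cnj a\<close> is the square of \<open>U 0\<close>, and removing the square of the
  tangent leaves the doubled angle.\<close>

lemma direction_in_subalg:
  assumes A: "fin_subalg A"
    and vA: "\<And>i. i < d \<Longrightarrow> v i \<in> A \<and> cnj (v i) \<in> A"
    and tA: "\<And>i. i < d \<Longrightarrow> (tang i)\<^sup>2 \<in> A \<and> cnj ((tang i)\<^sup>2) \<in> A"
  shows "cis (2 * th 0) \<in> A"
proof -
  obtain m a L where *: "a \<in> A" "cnj a \<in> A" "L > 0" "m * U p = U 0" "m * Q p + a = Q 0 + of_real L * U 0"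
    using unfold_orbit[OF assms, of p] p by auto
  have per: "U p = U 0" "Q p = Q 0" using periodic[of 0] by (auto simp: U_def Q_def)
  have "m = 1" using *(4) per U_nz[of 0] by simp
  then have a: "a = of_real L * U 0" using *(5) per by simp
  have UU: "U 0 * cnj (U 0) = 1" using norm_U[of 0] by (simp add: complex_norm_square[symmetric])
  have "a * inverse (cnj a) = U 0 * inverse (cnj (U 0))" using a *(3) by simp
  also have "inverse (cnj (U 0)) = U 0" using UU by (metis inverse_unique mult.commute)
  finally have "U 0 * U 0 \<in> A" using fin_subalgD(2)[OF A *(1) fin_subalg_inverse[OF A *(2)]] by simp
  moreover have t: "cnj ((tang (I 0))\<^sup>2) \<in> A" using tA valid_z by blast
  ultimately have "- (U 0 * U 0 * cnj ((tang (I 0))\<^sup>2)) \<in> A" using fin_subalgD(2,6)[OF A] by blast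
  also have "- (U 0 * U 0 * cnj ((tang (I 0))\<^sup>2)) = (tang (I 0) * cnj (tang (I 0)))\<^sup>2 * (cis (th 0) * cis (th 0))"
    by (simp add: U_def power2_eq_square algebra_simps)
  also have "\<dots> = cis (2 * th 0)" using tang_cnj valid_z by (simp add: cis_mult)
  finally show ?thesis .
qed

end

context simple_poly
begin

text \<open>Adjoining the imaginary unit and the real coordinates provides the conjugates of the
  vertices; the squared tangent is then the edge vector divided by its conjugate.\<close>

lemma exists_subalg:
  assumes "algebraic_vertices v d"
  shows "\<exists>A. fin_subalg A \<and> (\<forall>i<d. v i \<in> A \<and> cnj (v i) \<in> A) \<and>
     (\<forall>i<d. (tang i)\<^sup>2 \<in> A \<and> cnj ((tang i)\<^sup>2) \<in> A)"
proof -
  let ?S = "insert \<i> ((\<lambda>i. of_real (Re (v i))) ` {..<d} \<union> (\<lambda>i. of_real (Im (v i))) ` {..<d})"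
  have "\<exists>A. fin_subalg A \<and> ?S \<subseteq> A"
    using assms by (intro fin_subalg_contains_finite) (auto simp: algebraic_vertices_def)
  then obtain A where A: "fin_subalg A" "?S \<subseteq> A" by blast
  note cl = fin_subalgD[OF A(1)]
  have vA: "v i \<in> A \<and> cnj (v i) \<in> A" if "i < d" for i
  proof -
    have *: "\<i> \<in> A" "of_real (Re (v i)) \<in> A" "of_real (Im (v i)) \<in> A" using A that by auto
    have "v i = of_real (Re (v i)) + \<i> * of_real (Im (v i))"
      "cnj (v i) = of_real (Re (v i)) - \<i> * of_real (Im (v i))" by (auto simp: complex_eq_iff)
    then show ?thesis using * cl(1,2,5) by metis
  qed
  have tA: "(tang i)\<^sup>2 \<in> A \<and> cnj ((tang i)\<^sup>2) \<in> A" if i: "i < d" for i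
  proof -
    define e where "e = v (nxt d i) - v i"
    have eA: "e \<in> A" "cnj e \<in> A" using vA i nxt_less cl(5) by (auto simp: e_def)
    have "e \<noteq> 0" using len_pos[OF i] by (auto simp: e_def side_len_def)
    moreover have "(of_real (len i))\<^sup>2 = e * cnj e"
      unfolding complex_norm_square[symmetric] by (simp add: side_len_def e_def)
    ultimately have "(tang i)\<^sup>2 = e * inverse (cnj e)"
      by (simp add: unit_tan_def e_def[symmetric] power_divide power2_eq_square field_simps)
    then show ?thesis using eA cl(2) fin_subalg_inverse[OF A(1)] by simp
  qed
  show ?thesis using A vA tA by blast
qed

end

section \<open>Finiteness of the stable cylinders\<close>

context simple_poly
begin

section \<open>Independence of a cylinder from its base state\<close>

definition cylinder_of :: "real \<times> real \<Rightarrow> (real \<times> real) set" where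
  "cylinder_of x = {w. \<exists>y\<in>cyl_base v d x. \<exists>k. orb v d 1 y k = Some w}"

lemma angles_agree:
  assumes "is_orbit 1 z" "is_orbit 1 z'" "\<And>k. sd (fst (z' k)) = sd (fst (z k))" "snd (z' 0) = snd (z 0)"
  shows "snd (z' k) = snd (z k)"
proof (induction k)
  case (Suc k)
  have "snd (z (Suc k)) = 1 * Arg (- tang (sd (fst (z (Suc k)))) * cnj (tang (sd (fst (z k)))) * cis (- snd (z k)))"
    "snd (z' (Suc k)) = 1 * Arg (- tang (sd (fst (z' (Suc k)))) * cnj (tang (sd (fst (z' k)))) * cis (- snd (z' k)))"
    using assms(1,2) unfolding is_orbit_def pinball_eq_Some_iff by blast+
  then show ?case using Suc assms(3) by simp
qed (use assms in simp)

text \<open>Parallel orbits with the same itinerary keep equal angles forever, so the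
  \<open>k\<close>-th state of each lies in the base over \<open>z k\<close>.\<close>

lemma cylinder_of_subset_shift:
  assumes "is_orbit 1 z"
  shows "cylinder_of (z 0) \<subseteq> cylinder_of (z k)"
proof
  fix w assume "w \<in> cylinder_of (z 0)"
  then obtain y m where y: "y \<in> cyl_base v d (z 0)" "orb v d 1 y m = Some w" by (auto simp: cylinder_of_def)
  obtain z' p where z': "p > 0" "z' 0 = y" "is_orbit 1 z'" "\<And>k. z' (k + p) = z' k"
    using y periodic_ptE[of 1 y] unfolding cyl_base_def by blast
  have s: "sd (fst (z' j)) = sd (fst (z j))" for j
  proof -
    have "itin v d 1 (z' 0) = itin v d 1 (z 0)" using y z' by (simp add: cyl_base_def)
    from fun_cong[OF this, of j] show ?thesis
      using is_orbit_itin[OF assms, of 0] is_orbit_itin[OF z'(3), of 0] by simp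
  qed
  have a: "snd (z' j) = snd (z j)" for j
    using angles_agree[OF assms z'(3) s] y z' by (simp add: cyl_base_def)
  have "z' k \<in> cyl_base v d (z k)"
    using is_orbit_periodic[OF z'(3,1,4)] is_orbit_itin[OF assms, of k] is_orbit_itin[OF z'(3), of k] s a
    by (simp add: cyl_base_def)
  \<comment> \<open>Adding \<open>k\<close> full periods makes the target time at least
    \<open>k\<close>, so that \<open>w\<close> is reached going forward from
    \<open>z' k\<close>.\<close>
  moreover have "orb v d 1 (z' k) (m + k * p - k) = Some w"
  proof -
    have "k \<le> k * p" using z' by simp
    then have "k \<le> m + k * p" by linarith
    then have "orb v d 1 (z' k) (m + k * p - k) = Some (z' (m + k * p))"
      using is_orbit_orb[OF z'(3), of k "m + k * p - k"] by simp
    also have "z' (m + k * p) = z' m" by (rule periodic_mult) (rule z')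
    also have "Some (z' m) = Some w" using is_orbit_orb[OF z'(3), of 0 m] y z' by simp
    finally show ?thesis .
  qed
  ultimately show "w \<in> cylinder_of (z k)" unfolding cylinder_of_def by blast
qed

lemma cylinder_of_shift:
  assumes "is_orbit 1 z" "p > 0" "\<And>k. z (k + p) = z k"
  shows "cylinder_of (z k) = cylinder_of (z 0)"
proof
  have "cylinder_of (z (k + 0)) \<subseteq> cylinder_of (z (k + (k * p - k)))"
    using cylinder_of_subset_shift[OF is_orbit_shift[OF assms(1), of k], of "k * p - k"] .
  moreover have "k + (k * p - k) = 0 + k * p" using assms(2) by simp
  moreover have "z (0 + k * p) = z 0" by (rule periodic_mult) (rule assms)
  ultimately show "cylinder_of (z k) \<subseteq> cylinder_of (z 0)" by simp
qed (rule cylinder_of_subset_shift[OF assms(1)])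

text \<open>Allows the stable orbit found inside a cylinder to serve as its base.\<close>

lemma cylinder_of_mem:
  assumes "x \<in> cylinder_of x0"
  shows "cylinder_of x0 = cylinder_of x"
proof -
  obtain y k where y: "y \<in> cyl_base v d x0" "orb v d 1 y k = Some x" using assms by (auto simp: cylinder_of_def)
  then obtain z p where z: "p > 0" "z 0 = y" "is_orbit 1 z" "\<And>k. z (k + p) = z k"
    using periodic_ptE[of 1 y] unfolding cyl_base_def by blast
  have "z k = x" using is_orbit_orb[OF z(3), of 0 k] y z by simp
  then have "cylinder_of x = cylinder_of y" using cylinder_of_shift[OF z(3,1,4), of k] z by simp
  moreover have "cyl_base v d y = cyl_base v d x0" using y by (auto simp: cyl_base_def)
  ultimately show ?thesis by (simp add: cylinder_of_def)
qed

text \<open>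
  Records where, at the boundary of the family parallel to an orbit, a segment of the limiting
  trajectory runs into a vertex; the parity says on which side of that position the family lies.
\<close>
definition boundary_key :: "(real \<times> real) set \<Rightarrow> nat \<times> real \<times> real \<times> bool \<Rightarrow> bool" where
  "boundary_key C K \<longleftrightarrow> (\<exists>z p k. billiard_orbit v d z p \<and> C = cylinder_of (z 0) \<and>
     K = (billiard_orbit.I v d z k, billiard_orbit.th z k,
          billiard_orbit.Rh v d z k (billiard_orbit.edge v d z), even k))"

text \<open>Equal keys place both families on the same side of a common limiting point. Moving
  inward by the same \<open>e\<close> gives a phase point common to both, and it determines the
  cylinder.\<close>

lemma boundary_key_inj:
  assumes "boundary_key C K" "boundary_key C' K"
  shows "C = C'"
proof -
  obtain z p k where z: "billiard_orbit v d z p" "C = cylinder_of (z 0)"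
     "K = (billiard_orbit.I v d z k, billiard_orbit.th z k,
          billiard_orbit.Rh v d z k (billiard_orbit.edge v d z), even k)"
    using assms(1) unfolding boundary_key_def by blast
  obtain z' p' k' where z': "billiard_orbit v d z' p'" "C' = cylinder_of (z' 0)"
     "K = (billiard_orbit.I v d z' k', billiard_orbit.th z' k',
          billiard_orbit.Rh v d z' k' (billiard_orbit.edge v d z'), even k')"
    using assms(2) unfolding boundary_key_def by blast
  interpret A: billiard_orbit v d z p by (rule z)
  interpret B: billiard_orbit v d z' p' by (rule z')
  \<comment> \<open>The largest step that keeps both displacements at most 0, the range where
    \<open>zh_orbit\<close> applies.\<close>
  define e where "e = min (- A.edge) (- B.edge)"
  have e: "e > 0" "A.edge + e \<le> 0" "B.edge + e \<le> 0"
    using A.edge(2) B.edge(2) by (auto simp: e_def)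
  have eq: "A.I k = B.I k'" "A.th k = B.th k'" "A.Rh k A.edge = B.Rh k' B.edge" "even k = even k'"
    using z(3) z'(3) by auto
  have "A.c k = B.c k'" using eq by (simp add: A.c_def B.c_def minus_one_power_iff)
  then have "A.Rh k (A.edge + e) = B.Rh k' (B.edge + e)"
    using eq(3) by (simp add: A.Rh_def B.Rh_def algebra_simps)
  then have zz: "A.zh (A.edge + e) k = B.zh (B.edge + e) k'"
    using eq by (simp add: A.zh_def B.zh_def)
  have nA: "\<And>h'. A.edge + e \<le> h' \<Longrightarrow> h' \<le> 0 \<Longrightarrow> h' \<notin> A.vertex_hits" using A.edge(3) e by force
  have nB: "\<And>h'. B.edge + e \<le> h' \<Longrightarrow> h' \<le> 0 \<Longrightarrow> h' \<notin> B.vertex_hits" using B.edge(3) e by force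
  note oA = A.zh_orbit[OF e(2) nA] and oB = B.zh_orbit[OF e(3) nB]
  have "cyl_base v d (z 0) = cyl_base v d (A.zh (A.edge + e) 0)"
    using is_orbit_itin[OF oA(1), of 0] is_orbit_itin[OF A.orbit, of 0] oA(2)
    by (simp add: cyl_base_def A.I_def A.zh_def A.th_def)
  then have 1: "C = cylinder_of (A.zh (A.edge + e) 0)" using z by (simp add: cylinder_of_def)
  have "cyl_base v d (z' 0) = cyl_base v d (B.zh (B.edge + e) 0)"
    using is_orbit_itin[OF oB(1), of 0] is_orbit_itin[OF B.orbit, of 0] oB(2)
    by (simp add: cyl_base_def B.I_def B.zh_def B.th_def)
  then have 2: "C' = cylinder_of (B.zh (B.edge + e) 0)" using z' by (simp add: cylinder_of_def)
  show ?thesis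
    unfolding 1 2 using cylinder_of_shift[OF oA(1) A.p(1) oA(3), of k] cylinder_of_shift[OF oB(1) B.p(1) oB(3), of k'] zz
    by simp
qed

text \<open>In the frame of side \<open>i\<close>, the line through \<open>v j\<close> at angle
  \<open>t\<close> meets the line of the side at one offset \<open>r\<close>, found by eliminating
  \<open>s\<close> from real and imaginary parts.\<close>

lemma finite_keys:
  assumes "finite Th" "\<And>t. t \<in> Th \<Longrightarrow> cos t > 0"
  shows "finite {(i, t, r, par :: bool). i < d \<and> t \<in> Th \<and>
     (\<exists>j<d. \<exists>s. v j = pt i r + of_real s * (\<i> * tang i * cis t))}" (is "finite ?K")
proof -
  let ?w = "\<lambda>i j. (v j - v i) / tang i"
  let ?f = "\<lambda>(i, t, j, par). (i, t, Re (?w i j) + Im (?w i j) * sin t / cos t, par)"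
  have "?K \<subseteq> ?f ` ({..<d} \<times> Th \<times> {..<d} \<times> (UNIV :: bool set))"
  proof (clarify)
    fix i t r and par :: bool and j s
    assume a: "i < d" "t \<in> Th" "j < d" "v j = pt i r + of_real s * (\<i> * tang i * cis t)"
    have "?w i j = of_real r + of_real s * (\<i> * cis t)"
      using a(4) tang_nz[OF a(1)] by (simp add: pt_def field_simps)
    then have "Re (?w i j) = r - s * sin t" "Im (?w i j) = s * cos t" by simp_all
    then have "r = Re (?w i j) + Im (?w i j) * sin t / cos t" using assms(2)[OF a(2)] by simp
    then show "(i, t, r, par) \<in> ?f ` ({..<d} \<times> Th \<times> {..<d} \<times> UNIV)"
      using a by (intro image_eqI[of _ _ "(i, t, j, par)"]) auto
  qed
  moreover have "finite (?f ` ({..<d} \<times> Th \<times> {..<d} \<times> (UNIV :: bool set)))" using assms by auto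
  ultimately show ?thesis by (rule finite_subset)
qed

theorem finite_lambda_stable_cylinders:
  assumes rat: "rational_polygon v d" and alg: "algebraic_vertices v d"
  shows "finite {C. lambda_stable_cylinder v d C}"
proof -
  obtain A where A: "fin_subalg A" "\<And>i. i < d \<Longrightarrow> v i \<in> A \<and> cnj (v i) \<in> A"
     "\<And>i. i < d \<Longrightarrow> (tang i)\<^sup>2 \<in> A \<and> cnj ((tang i)\<^sup>2) \<in> A"
    using exists_subalg[OF alg] by blast
  define Th where "Th = {t. - (pi/2) < t \<and> t < pi/2 \<and> cis (2 * t) \<in> A \<and> root_of_unity (cis (2 * t))}"
  \<comment> \<open>Angles in \<open>Th\<close> lie strictly within \<open>pi / 2\<close> of 0, so
    doubling stays inside the principal range and no information is lost.\<close>
  have "Arg (cis (2 * t)) = 2 * t" if "t \<in> Th" for t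
    using that by (auto simp: Th_def intro!: Arg_cis)
  then have "inj_on (\<lambda>t. cis (2 * t)) Th"
    by (intro inj_on_inverseI[where g = "\<lambda>w. Arg w / 2"]) simp
  moreover have "finite ((\<lambda>t. cis (2 * t)) ` Th)"
    by (rule finite_subset[OF _ finite_roots_of_unity_fin_subalg[OF A(1)]]) (auto simp: Th_def root_of_unity_def)
  ultimately have finTh: "finite Th" by (metis finite_imageD)
  define Ks where "Ks = {(i, t, r, par :: bool). i < d \<and> t \<in> Th \<and>
     (\<exists>j<d. \<exists>s. v j = pt i r + of_real s * (\<i> * tang i * cis t))}"
  have finK: "finite Ks"
    unfolding Ks_def by (rule finite_keys[OF finTh]) (auto simp: Th_def cos_gt_zero_pi)
  have key: "\<exists>K\<in>Ks. boundary_key C K" if C: "lambda_stable_cylinder v d C" for C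
  proof -
    obtain x0 where x0: "C = cylinder_of x0"
      using C unfolding lambda_stable_cylinder_def periodic_cylinder_def cylinder_of_def by blast
    obtain x where x: "x \<in> C" "lam_plus_stable v d x" using C by (auto simp: lambda_stable_cylinder_def)
    have Cx: "C = cylinder_of x" using cylinder_of_mem x x0 by blast
    obtain z p where z: "p > 0" "even p" "z 0 = x" "is_orbit 1 z" "\<And>k. z (k + p) = z k"
      using x(2) periodic_ptE[of 1 x] unfolding lam_plus_stable_def by blast
    interpret B: billiard_orbit v d z p by unfold_locales (use z in auto)
    obtain lams ys where s: "\<And>n. lams (Suc n) < lams n" "lams \<longlonglongrightarrow> 1"
        "\<And>n. periodic_pt v d (lams n) (ys n)" "\<And>n. itin v d (lams n) (ys n) = itin v d 1 x" "ys \<longlonglongrightarrow> x"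
      using x(2) unfolding lam_plus_stable_def by blast
    have "decseq lams" using s(1) by (intro decseq_SucI) (auto intro: less_imp_le)
    then have "1 \<le> lams (Suc n)" for n using s(2) by (rule decseq_ge)
    then have ne: "lams n \<noteq> 1" for n using s(1)[of n] by (metis linorder_not_le)
    have r0: "B.th 0 / pi \<in> \<rat>"
      using B.stable_angle_rational[OF rat s(2), of ys] s ne z by auto
    have Th: "B.th k \<in> Th" for k
    proof -
      \<comment> \<open>The direction lemma speaks of the initial angle only; restarting the orbit
        at time \<open>k\<close> applies it to every collision.\<close>
      interpret Bk: billiard_orbit v d "\<lambda>j. z (k + j)" p
        by unfold_locales (use z is_orbit_shift in \<open>auto simp: add.assoc[symmetric]\<close>)
      have "Bk.th 0 = B.th k" by (simp add: Bk.th_def B.th_def)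
      then have "cis (2 * B.th k) \<in> A" using Bk.direction_in_subalg[OF A] by simp
      moreover have "root_of_unity (cis (B.th k) * cis (B.th k))" using root_of_unity_mult B.root_of_unity_all_angles[OF rat r0] by blast
      then have "root_of_unity (cis (2 * B.th k))" by (simp add: cis_mult)
      ultimately show ?thesis using B.valid_z by (auto simp: Th_def)
    qed
    obtain k j where kj: "j < d" "v j \<in> closed_segment (B.Ph k B.edge) (B.Ph (Suc k) B.edge)"
      using B.edge(1) unfolding B.vertex_hits_def by blast
    then obtain s where "v j = B.Ph k B.edge + of_real s * B.U k" by (auto elim: B.segment_on_line)
    then have "(B.I k, B.th k, B.Rh k B.edge, even k) \<in> Ks"
      using kj Th B.valid_z by (auto simp: Ks_def B.Ph_def B.U_def)
    moreover have "boundary_key C (B.I k, B.th k, B.Rh k B.edge, even k)"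
      unfolding boundary_key_def using B.billiard_orbit_axioms Cx z by blast
    ultimately show ?thesis by blast
  qed
  have "{C. lambda_stable_cylinder v d C} \<subseteq> (\<lambda>K. THE C. boundary_key C K) ` Ks"
  proof clarify
    fix C assume "lambda_stable_cylinder v d C"
    then obtain K where K: "K \<in> Ks" "boundary_key C K" using key by blast
    have "(THE C. boundary_key C K) = C"
      by (rule the_equality, rule K(2), rule boundary_key_inj[OF _ K(2)])
    then show "C \<in> (\<lambda>K. THE C. boundary_key C K) ` Ks" using K(1) by (intro image_eqI[of _ _ K]) auto
  qed
  then show ?thesis by (rule finite_subset) (rule finite_imageI[OF finK])
qed

end

theorem theorem4p1:
  fixes v :: "nat \<Rightarrow> complex" and d :: nat
  assumes "simple_polygon v d" and "ccw v d"
    and "rational_polygon v d" and "algebraic_vertices v d"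
  shows "finite {C. lambda_stable_cylinder v d C}"
proof -
  interpret simple_poly v d by unfold_locales (rule assms(1))
  show ?thesis using assms finite_lambda_stable_cylinders by blast
qed

end
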